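(* Let $n\ge 1$. As ${\mathfrak S}_n$-modules, $MHar_n \simeq {\mathcal A}_n' \otimes {\mathcal H}_n$, where ${\mathfrak S}_n$ acts diagonally on the tensor product.
   Context: ${\mathbb Q}\langle X_n\rangle={\mathbb Q}\langle x_1,\dots,x_n\rangle$ is the algebra of polynomials in noncommuting variables, graded by degree, with ${\mathfrak S}_n$ permuting the variables. $NCSym_n$ is the subspace of ${\mathfrak S}_n$-invariant polynomials, $\mathfrak M_n=\{p\in NCSym_n: p(0)=0\}$. The Hausdorff derivative $\partial_x$ sends a word $w$ to the sum of the subwords obtained by deleting one occurrence of the letter $x$ (summed over all occurrences), extended linearly; $p(\partial_{X_n})$ is obtained from $p$ by replacing each $x_i$ by $\partial_{x_i}$. $MHar_n=\{f\in{\mathbb Q}\langle X_n\rangle: p(\partial_{X_n})f=0 \ \forall p\in\mathfrak M_n\}$. ${\mathcal L}_n$ is the free Lie algebra realized in ${\mathbb Q}\langle X_n\rangle$: the smallest subspace containing $x_1,\dots,x_n$ and closed under $[a,b]=ab-ba$; ${\mathcal L}_n'=[{\mathcal L}_n,{\mathcal L}_n]$ is the derived free Lie algebra, and ${\mathcal A}_n'$ is its enveloping algebra realized as the (unital) subalgebra of ${\mathbb Q}\langle X_n\rangle$ generated by ${\mathcal L}_n'$, equivalently ${\mathcal A}_n'=\bigcap_{i}\ker\partial_{x_i}$; it is a graded ${\mathfrak S}_n$-submodule. ${\mathcal H}_n$ is the space of (commutative) harmonic polynomials of ${\mathfrak S}_n$: ${\mathcal H}_n=\{f\in{\mathbb Q}[x_1,\dots,x_n]: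 p(\partial/\partial x_1,\dots,\partial/\partial x_n)f=0$ for all symmetric polynomials $p$ with $p(0)=0\}$, with ${\mathfrak S}_n$ permuting variables. *)

theory Defs
  imports Complex_Main "HOL-Library.Poly_Mapping"
begin

text \<open>
  The variables are indexed by a finite type \<open>'n\<close>, so the number of variables is \<open>CARD('n) \<ge> 1\<close> and
  the symmetric group is the set of bijections \<open>'n \<Rightarrow> 'n\<close>.  Noncommutative polynomials are finitely
  supported functions on words, commutative polynomials are finitely supported functions on
  exponent vectors; both get their multiplication from the convolution product of
  \<open>Poly_Mapping\<close>.
\<close>

text \<open>The free monoid: makes \<open>'n list \<Rightarrow>\<^sub>0 rat\<close> the free associative algebra, with unit \<open>single [] 1\<close>.\<close>

instantiation list :: (type) monoid_add
begin
definition zero_list :: "'a list" where "0 = []"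
definition plus_list :: "'a list \<Rightarrow> 'a list \<Rightarrow> 'a list" where "xs + ys = xs @ ys"
instance by standard (simp_all add: zero_list_def plus_list_def)
end

type_synonym 'n ncpoly = "'n list \<Rightarrow>\<^sub>0 rat"
type_synonym 'n cpoly = "('n \<Rightarrow>\<^sub>0 nat) \<Rightarrow>\<^sub>0 rat"


section \<open>Linear algebra of finitely supported functions\<close>

definition pscale :: "rat \<Rightarrow> ('a \<Rightarrow>\<^sub>0 rat) \<Rightarrow> ('a \<Rightarrow>\<^sub>0 rat)" where
  "pscale c p = Poly_Mapping.map ((*) c) p"

lemma lookup_pscale [simp]: "Poly_Mapping.lookup (pscale c p) a = c * Poly_Mapping.lookup p a"
  by (simp add: pscale_def Poly_Mapping.map.rep_eq when_def)

global_interpretation pm: vector_space pscale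
  by standard (auto intro!: poly_mapping_eqI simp: lookup_add algebra_simps)

text \<open>The linear map with prescribed values \<open>f a\<close> on the basis vectors \<open>single a 1\<close>.\<close>

definition pm_extend :: "('a \<Rightarrow> ('b \<Rightarrow>\<^sub>0 rat)) \<Rightarrow> ('a \<Rightarrow>\<^sub>0 rat) \<Rightarrow> ('b \<Rightarrow>\<^sub>0 rat)" where
  "pm_extend f p = (\<Sum>a\<in>Poly_Mapping.keys p. pscale (Poly_Mapping.lookup p a) (f a))"

lemma pm_extend_superset:
  assumes "finite A" "Poly_Mapping.keys p \<subseteq> A"
  shows "pm_extend f p = (\<Sum>a\<in>A. pscale (Poly_Mapping.lookup p a) (f a))"
  unfolding pm_extend_def
  by (rule sum.mono_neutral_left) (use assms in \<open>auto simp: in_keys_iff\<close>)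

lemma pm_extend_single [simp]: "pm_extend f (Poly_Mapping.single a c) = pscale c (f a)"
  by (subst pm_extend_superset[of "{a}"]) auto

lemma pm_extend_add: "pm_extend f (p + q) = pm_extend f p + pm_extend f q"
proof -
  let ?A = "Poly_Mapping.keys p \<union> Poly_Mapping.keys q"
  have "Poly_Mapping.keys (p + q) \<subseteq> ?A"
    by (rule keys_add)
  then show ?thesis
    by (simp add: pm_extend_superset[of ?A] lookup_add pm.scale_left_distrib sum.distrib)
qed

lemma pm_extend_pscale: "pm_extend f (pscale c p) = pscale c (pm_extend f p)"
proof -
  have "Poly_Mapping.keys (pscale c p) \<subseteq> Poly_Mapping.keys p"
    by (auto simp: in_keys_iff)
  then show ?thesis
    by (simp add: pm_extend_superset[of "Poly_Mapping.keys p"] pm.scale_sum_right)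
qed

lemma linear_pm_extend: "Vector_Spaces.linear pscale pscale (pm_extend f)"
  by unfold_locales (simp_all add: pm_extend_add pm_extend_pscale)


section \<open>Modules over the symmetric group\<close>

definition Sn_module :: "(('n \<Rightarrow> 'n) \<Rightarrow> ('a \<Rightarrow>\<^sub>0 rat) \<Rightarrow> ('a \<Rightarrow>\<^sub>0 rat)) \<Rightarrow> ('a \<Rightarrow>\<^sub>0 rat) set \<Rightarrow> bool" where
  "Sn_module act V \<longleftrightarrow>
     pm.subspace V \<and>
     (\<forall>\<sigma>. bij \<sigma> \<longrightarrow>
        (\<forall>v\<in>V. act \<sigma> v \<in> V) \<and>
        (\<forall>u\<in>V. \<forall>v\<in>V. act \<sigma> (u + v) = act \<sigma> u + act \<sigma> v) \<and>
        (\<forall>c. \<forall>v\<in>V. act \<sigma> (pscale c v) = pscale c (act \<sigma> v))) \<and>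
     (\<forall>v\<in>V. act id v = v) \<and>
     (\<forall>\<sigma> \<tau>. bij \<sigma> \<longrightarrow> bij \<tau> \<longrightarrow> (\<forall>v\<in>V. act (\<sigma> \<circ> \<tau>) v = act \<sigma> (act \<tau> v)))"

definition Sn_isomorphic ::
  "(('n \<Rightarrow> 'n) \<Rightarrow> ('a \<Rightarrow>\<^sub>0 rat) \<Rightarrow> ('a \<Rightarrow>\<^sub>0 rat)) \<Rightarrow> ('a \<Rightarrow>\<^sub>0 rat) set \<Rightarrow>
   (('n \<Rightarrow> 'n) \<Rightarrow> ('b \<Rightarrow>\<^sub>0 rat) \<Rightarrow> ('b \<Rightarrow>\<^sub>0 rat)) \<Rightarrow> ('b \<Rightarrow>\<^sub>0 rat) set \<Rightarrow> bool" where
  "Sn_isomorphic act V act' W \<longleftrightarrow>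
     Sn_module act V \<and> Sn_module act' W \<and>
     (\<exists>\<phi>. bij_betw \<phi> V W \<and>
        (\<forall>u\<in>V. \<forall>v\<in>V. \<phi> (u + v) = \<phi> u + \<phi> v) \<and>
        (\<forall>c. \<forall>v\<in>V. \<phi> (pscale c v) = pscale c (\<phi> v)) \<and>
        (\<forall>\<sigma>. bij \<sigma> \<longrightarrow> (\<forall>v\<in>V. \<phi> (act \<sigma> v) = act' \<sigma> (\<phi> v))))"


section \<open>Noncommutative polynomials\<close>

definition nc_var :: "'n \<Rightarrow> 'n ncpoly" where
  "nc_var i = Poly_Mapping.single [i] 1"

definition nc_perm :: "('n \<Rightarrow> 'n) \<Rightarrow> 'n ncpoly \<Rightarrow> 'n ncpoly" where
  "nc_perm \<sigma> = pm_extend (\<lambda>w. Poly_Mapping.single (map \<sigma> w) 1)"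

definition NCSym :: "'n ncpoly set" where
  "NCSym = {p. \<forall>\<sigma>. bij \<sigma> \<longrightarrow> nc_perm \<sigma> p = p}"

text \<open>Here \<open>p(0)\<close> is the coefficient of the empty word.\<close>

definition NCSym_plus :: "'n ncpoly set" where
  "NCSym_plus = {p \<in> NCSym. Poly_Mapping.lookup p [] = 0}"

definition hausdorff_deriv :: "'n \<Rightarrow> 'n ncpoly \<Rightarrow> 'n ncpoly" where
  "hausdorff_deriv i = pm_extend (\<lambda>w.
     \<Sum>k | k < length w \<and> w ! k = i. Poly_Mapping.single (take k w @ drop (Suc k) w) 1)"

text \<open>\<open>nc_diff p f\<close> is \<open>p(\<partial>) f\<close>: the word \<open>[i\<^sub>1, \<dots>, i\<^sub>k]\<close> acts as \<open>\<partial>\<^sub>i\<^sub>1 \<circ> \<dots> \<circ> \<partial>\<^sub>i\<^sub>k\<close>.\<close>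

definition nc_diff :: "'n ncpoly \<Rightarrow> 'n ncpoly \<Rightarrow> 'n ncpoly" where
  "nc_diff p f = pm_extend (\<lambda>w. foldr hausdorff_deriv w f) p"

definition MHar :: "'n ncpoly set" where
  "MHar = {f. \<forall>p\<in>NCSym_plus. nc_diff p f = 0}"

definition lie_bracket :: "'n ncpoly \<Rightarrow> 'n ncpoly \<Rightarrow> 'n ncpoly" where
  "lie_bracket a b = a * b - b * a"

definition free_lie :: "'n ncpoly set" where
  "free_lie = \<Inter>{L. pm.subspace L \<and> (\<forall>i. nc_var i \<in> L) \<and> (\<forall>a\<in>L. \<forall>b\<in>L. lie_bracket a b \<in> L)}"

definition derived_free_lie :: "'n ncpoly set" where
  "derived_free_lie = pm.span {lie_bracket a b |a b. a \<in> free_lie \<and> b \<in> free_lie}"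

text \<open>The enveloping algebra of the derived free Lie algebra, as a unital subalgebra.\<close>

definition env_derived :: "'n ncpoly set" where
  "env_derived = \<Inter>{A. pm.subspace A \<and> 1 \<in> A \<and> (\<forall>a\<in>A. \<forall>b\<in>A. a * b \<in> A) \<and> derived_free_lie \<subseteq> A}"


section \<open>Commutative polynomials\<close>

definition c_perm :: "('n::finite \<Rightarrow> 'n) \<Rightarrow> 'n cpoly \<Rightarrow> 'n cpoly" where
  "c_perm \<sigma> = pm_extend (\<lambda>m.
     Poly_Mapping.single (\<Sum>i\<in>UNIV. Poly_Mapping.single (\<sigma> i) (Poly_Mapping.lookup m i)) 1)"

definition c_Sym_plus :: "'n::finite cpoly set" where
  "c_Sym_plus = {p. (\<forall>\<sigma>. bij \<sigma> \<longrightarrow> c_perm \<sigma> p = p) \<and> Poly_Mapping.lookup p 0 = 0}"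

text \<open>If \<open>x\<^sub>i\<close> does not occur in \<open>m\<close>, the subtraction truncates but the coefficient is zero.\<close>

definition partial_deriv :: "'n \<Rightarrow> 'n cpoly \<Rightarrow> 'n cpoly" where
  "partial_deriv i = pm_extend (\<lambda>m.
     Poly_Mapping.single (m - Poly_Mapping.single i 1) (of_nat (Poly_Mapping.lookup m i)))"

text \<open>
  The monomial \<open>m\<close> acts as the composition of the operators \<open>(\<partial>/\<partial>x\<^sub>i)\<^bsup>m i\<^esup>\<close>.  The fold is well defined
  because these commute, see \<open>comp_fun_commute_partial_deriv\<close> below.
\<close>

definition c_diff :: "'n::finite cpoly \<Rightarrow> 'n cpoly \<Rightarrow> 'n cpoly" where
  "c_diff p f =
     pm_extend (\<lambda>m. Finite_Set.fold (\<lambda>i. partial_deriv i ^^ Poly_Mapping.lookup m i) f UNIV) p"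

definition harmonic :: "'n::finite cpoly set" where
  "harmonic = {f. \<forall>p\<in>c_Sym_plus. c_diff p f = 0}"

lemma pm_extend_pm_extend: "pm_extend g (pm_extend f p) = pm_extend (\<lambda>a. pm_extend g (f a)) p"
proof -
  interpret l: Vector_Spaces.linear pscale pscale "pm_extend g"
    by (rule linear_pm_extend)
  show ?thesis
    by (simp add: pm_extend_def[of f] pm_extend_def[of "\<lambda>a. pm_extend g (f a)"] l.sum l.scale)
qed

lemma partial_deriv_commute:
  "partial_deriv i (partial_deriv j f) = partial_deriv j (partial_deriv i f)"
proof (cases "i = j")
  case False
  have "m - Poly_Mapping.single i (Suc 0) - Poly_Mapping.single j (Suc 0) =
      m - Poly_Mapping.single j (Suc 0) - Poly_Mapping.single i (Suc 0)" for m :: "'a \<Rightarrow>\<^sub>0 nat"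
    by (metis diff_diff_add add.commute)
  moreover have "pscale c (Poly_Mapping.single a d) = Poly_Mapping.single a (c * d)"
    for c d and a :: "'a \<Rightarrow>\<^sub>0 nat"
    by (rule poly_mapping_eqI) (simp add: lookup_single when_def)
  ultimately show ?thesis
    using False
    by (simp add: partial_deriv_def pm_extend_pm_extend lookup_minus lookup_single mult.commute)
qed simp

lemma funpow_commute:
  assumes "\<And>x. f (g x) = g (f x)"
  shows "(f ^^ m) ((g ^^ k) x) = (g ^^ k) ((f ^^ m) x)"
proof -
  have *: "f ((g ^^ k) x) = (g ^^ k) (f x)" for x
    by (induction k) (simp_all add: assms)
  show ?thesis
    by (induction m) (simp_all add: *)
qed

lemma comp_fun_commute_partial_deriv:
  "comp_fun_commute_on UNIV (\<lambda>i. partial_deriv i ^^ Poly_Mapping.lookup m i)"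
  by standard (auto simp: fun_eq_iff intro!: funpow_commute partial_deriv_commute)


section \<open>Tensor products\<close>

text \<open>
  The tensor product of two spaces of finitely supported functions is realised inside the finitely
  supported functions on pairs, \<open>a \<otimes> h\<close> being \<open>(w, m) \<mapsto> a w * h m\<close>.  By \<open>tensor_independent\<close> below,
  tensors of linearly independent families are independent, so \<open>tensor_space V W\<close> is the
  tensor product over the rationals of the subspaces \<open>V\<close> and \<open>W\<close>.
\<close>

definition tensor :: "('a \<Rightarrow>\<^sub>0 rat) \<Rightarrow> ('b \<Rightarrow>\<^sub>0 rat) \<Rightarrow> ('a \<times> 'b \<Rightarrow>\<^sub>0 rat)" where
  "tensor a h = pm_extend (\<lambda>w. pm_extend (\<lambda>m. Poly_Mapping.single (w, m) 1) h) a"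

definition tensor_space ::
  "('a \<Rightarrow>\<^sub>0 rat) set \<Rightarrow> ('b \<Rightarrow>\<^sub>0 rat) set \<Rightarrow> ('a \<times> 'b \<Rightarrow>\<^sub>0 rat) set" where
  "tensor_space V W = pm.span {tensor a h |a h. a \<in> V \<and> h \<in> W}"

definition diag_perm ::
  "('n::finite \<Rightarrow> 'n) \<Rightarrow> ('n list \<times> ('n \<Rightarrow>\<^sub>0 nat) \<Rightarrow>\<^sub>0 rat) \<Rightarrow> ('n list \<times> ('n \<Rightarrow>\<^sub>0 nat) \<Rightarrow>\<^sub>0 rat)" where
  "diag_perm \<sigma> = pm_extend (\<lambda>(w, m).
     tensor (nc_perm \<sigma> (Poly_Mapping.single w 1)) (c_perm \<sigma> (Poly_Mapping.single m 1)))"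

lemma lookup_tensor:
  "Poly_Mapping.lookup (tensor a h) (w, m) = Poly_Mapping.lookup a w * Poly_Mapping.lookup h m"
proof -
  have 1: "Poly_Mapping.lookup (pm_extend f p) b =
      (\<Sum>a\<in>Poly_Mapping.keys p. Poly_Mapping.lookup p a * Poly_Mapping.lookup (f a) b)"
    for f :: "'c \<Rightarrow> ('d \<Rightarrow>\<^sub>0 rat)" and p b
    by (simp add: pm_extend_def lookup_sum)
  have "Poly_Mapping.lookup (pm_extend (\<lambda>m. Poly_Mapping.single (w', m) 1) h) (w, m) =
      (if w' = w then Poly_Mapping.lookup h m else 0)" for w'
    unfolding 1
    by (auto simp: lookup_single when_def in_keys_iff if_distrib[of "(*) _"] sum.delta'
        cong: if_cong)
  then show ?thesis
    unfolding tensor_def 1[of _ a]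
    by (auto simp: in_keys_iff if_distrib[of "(*) _"] sum.delta' cong: if_cong)
qed

lemma tensor_bilinear:
  "tensor (a + b) h = tensor a h + tensor b h"
  "tensor a (h + k) = tensor a h + tensor a k"
  "tensor (pscale c a) h = pscale c (tensor a h)"
  "tensor a (pscale c h) = pscale c (tensor a h)"
  by (rule poly_mapping_eqI; auto simp: lookup_tensor lookup_add algebra_simps)+

lemma diag_perm_tensor: "diag_perm \<sigma> (tensor a h) = tensor (nc_perm \<sigma> a) (c_perm \<sigma> h)"
proof -
  have l: "tensor (pm_extend f p) h = pm_extend (\<lambda>a. tensor (f a) h) p"
    for f :: "'c \<Rightarrow> ('d \<Rightarrow>\<^sub>0 rat)" and p and h :: "'e \<Rightarrow>\<^sub>0 rat"
    by (rule poly_mapping_eqI)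
      (auto simp: lookup_tensor pm_extend_def lookup_sum sum_distrib_right mult.assoc)
  have r: "tensor a (pm_extend f p) = pm_extend (\<lambda>m. tensor a (f m)) p"
    for f :: "'c \<Rightarrow> ('d \<Rightarrow>\<^sub>0 rat)" and p and a :: "'e \<Rightarrow>\<^sub>0 rat"
    by (rule poly_mapping_eqI)
      (auto simp: lookup_tensor pm_extend_def lookup_sum sum_distrib_left algebra_simps)
  show ?thesis
    unfolding nc_perm_def c_perm_def l
    unfolding r
    by (simp add: tensor_def[of a h] diag_perm_def nc_perm_def c_perm_def pm_extend_pm_extend)
qed

lemma tensor_independent:
  assumes "pm.independent A" "pm.independent B"
    and F: "finite F" "F \<subseteq> A \<times> B" "(\<Sum>(a, b)\<in>F. pscale (c (a, b)) (tensor a b)) = 0"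
    and ab: "(a, b) \<in> F"
  shows "c (a, b) = 0"
proof -
  define c' where "c' = (\<lambda>x. if x \<in> F then c x else 0)"
  let ?A = "fst ` F" and ?B = "snd ` F"
  have fin: "finite ?A" "finite ?B" and sub: "?A \<subseteq> A" "?B \<subseteq> B"
    using F by auto
  have "(\<Sum>(a, b)\<in>F. pscale (c (a, b)) (tensor a b)) =
      (\<Sum>(a, b)\<in>?A \<times> ?B. pscale (c' (a, b)) (tensor a b))"
    by (rule sum.mono_neutral_cong_left) (use fin in \<open>force simp: c'_def\<close>)+
  then have 0: "(\<Sum>a\<in>?A. \<Sum>b\<in>?B. pscale (c' (a, b)) (tensor a b)) = 0"
    using F by (simp add: sum.cartesian_product)
  have 1: "(\<Sum>b\<in>?B. c' (a, b) * Poly_Mapping.lookup b m) = 0" if "a \<in> ?A" for a m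
  proof -
    have "(\<Sum>a\<in>?A. pscale (\<Sum>b\<in>?B. c' (a, b) * Poly_Mapping.lookup b m) a) = 0"
    proof (rule poly_mapping_eqI)
      fix w
      from 0 have "Poly_Mapping.lookup (\<Sum>a\<in>?A. \<Sum>b\<in>?B. pscale (c' (a, b)) (tensor a b)) (w, m) = 0"
        by simp
      then show "Poly_Mapping.lookup (\<Sum>a\<in>?A. pscale (\<Sum>b\<in>?B. c' (a, b) * Poly_Mapping.lookup b m) a) w =
          Poly_Mapping.lookup 0 w"
        by (simp add: lookup_sum lookup_tensor sum_distrib_right sum_distrib_left algebra_simps)
    qed
    from pm.independentD[OF assms(1) fin(1) sub(1) this that] show ?thesis .
  qed
  have "(\<Sum>b\<in>?B. pscale (c' (a, b)) b) = 0"
    by (rule poly_mapping_eqI) (use 1[of a] ab in \<open>force simp: lookup_sum\<close>)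
  then have "c' (a, b) = 0"
    using pm.independentD[OF assms(2) fin(2) sub(2), of "\<lambda>b. c' (a, b)" b] ab by force
  then show ?thesis
    using ab by (simp add: c'_def)
qed

end

theory Submission
  imports Defs
begin

text \<open>
  The Hausdorff derivatives are derivations that kill \<open>\<A>'\<close>, because they send Lie elements to
  constants.  The symmetrisation \<open>symz\<close> of commutative polynomials is equivariant and turns
  \<open>\<partial>/\<partial>x\<^sub>i\<close> into the Hausdorff derivative, so \<open>a \<otimes> h \<mapsto> a * symz h\<close> is an equivariant map from
  \<open>\<A>' \<otimes> \<rat>[X]\<close> to the free algebra under which \<open>p(\<partial>)\<close> becomes \<open>1 \<otimes> p(\<partial>)\<close>.  It is injective,
  as derivatives of top degree isolate single coefficients, and surjective, by induction on the
  degree: modulo \<open>\<A>'\<close>-multiples of shorter words, the letters of a word commute.  Finally, the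
  commutative images of the noncommutative symmetric polynomials are all symmetric polynomials, so
  the map restricts to an isomorphism from \<open>\<A>' \<otimes> \<H>\<close> onto \<open>MHar\<close>.
\<close>


section \<open>Linear maps on finitely supported functions\<close>

abbreviation pm_linear :: "(('a \<Rightarrow>\<^sub>0 rat) \<Rightarrow> ('b \<Rightarrow>\<^sub>0 rat)) \<Rightarrow> bool" where
  "pm_linear \<equiv> Vector_Spaces.linear pscale pscale"

lemma pm_linearI:
  assumes "\<And>p q. f (p + q) = f p + f q" "\<And>c p. f (pscale c p) = pscale c (f p)"
  shows "pm_linear f"
  by unfold_locales (simp_all add: assms)

lemma pm_linear_add: "pm_linear f \<Longrightarrow> f (p + q) = f p + f q"
  and pm_linear_pscale: "pm_linear f \<Longrightarrow> f (pscale c p) = pscale c (f p)"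
  and pm_linear_sum: "pm_linear f \<Longrightarrow> f (sum g A) = (\<Sum>x\<in>A. f (g x))"
  and pm_linear_0: "pm_linear f \<Longrightarrow> f 0 = 0"
  and pm_linear_diff: "pm_linear f \<Longrightarrow> f (p - q) = f p - f q"
  unfolding Vector_Spaces.linear_def
  by (blast intro: module_hom.add module_hom.scale module_hom.sum module_hom.zero module_hom.diff)+

lemma pm_expand: "p = (\<Sum>a\<in>Poly_Mapping.keys p. pscale (Poly_Mapping.lookup p a) (Poly_Mapping.single a 1))"
  by (rule poly_mapping_eqI)
    (auto simp: lookup_sum lookup_single when_def in_keys_iff if_distrib[of "(*) _"] sum.delta'
      cong: if_cong)

text \<open>Almost every operator identity below is reduced by this rule to single words or
  monomials.\<close>

lemma pm_linear_eqI:
  assumes "pm_linear f" "pm_linear g"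
    and "\<And>a. f (Poly_Mapping.single a 1) = g (Poly_Mapping.single a 1)"
  shows "f p = g p"
  by (subst (1 2) pm_expand) (simp add: assms pm_linear_sum pm_linear_pscale)

lemma pm_linear_comp: "pm_linear f \<Longrightarrow> pm_linear g \<Longrightarrow> pm_linear (\<lambda>p. f (g p))"
  by (rule pm_linearI) (simp_all add: pm_linear_add pm_linear_pscale)

lemma pm_linear_plus: "pm_linear f \<Longrightarrow> pm_linear g \<Longrightarrow> pm_linear (\<lambda>p. f p + g p)"
  by (rule pm_linearI) (simp_all add: pm_linear_add pm_linear_pscale pm.scale_right_distrib)

lemma pm_linear_id: "pm_linear (\<lambda>p. p)"
  by (rule pm_linearI) simp_all

lemma pscale_single [simp]: "pscale c (Poly_Mapping.single a d) = Poly_Mapping.single a (c * d)"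
  by (rule poly_mapping_eqI) (simp add: lookup_single when_def)

lemma pscale_eq_times:
  fixes p :: "'a::monoid_add \<Rightarrow>\<^sub>0 rat"
  shows "pscale c p = Poly_Mapping.single 0 c * p"
proof -
  have "Poly_Mapping.single 0 c * p = (\<Sum>a\<in>Poly_Mapping.keys p.
      Poly_Mapping.single 0 c * pscale (Poly_Mapping.lookup p a) (Poly_Mapping.single a 1))"
    by (subst (1) pm_expand[of p]) (simp only: sum_distrib_left)
  also have "\<dots> = pscale c (\<Sum>a\<in>Poly_Mapping.keys p.
      pscale (Poly_Mapping.lookup p a) (Poly_Mapping.single a 1))"
    by (simp add: mult_single pm.scale_sum_right)
  also have "\<dots> = pscale c p"
    by (simp only: pm_expand[symmetric])
  finally show ?thesis by simp
qed

text \<open>Constants are central although the algebra need not be commutative; with associativity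
  this makes the product bilinear.\<close>

lemma times_pscale:
  fixes p q :: "'a::monoid_add \<Rightarrow>\<^sub>0 rat"
  shows "p * pscale c q = pscale c (p * q)"
proof -
  have "p * Poly_Mapping.single 0 c = (\<Sum>a\<in>Poly_Mapping.keys p.
      pscale (Poly_Mapping.lookup p a) (Poly_Mapping.single a 1) * Poly_Mapping.single 0 c)"
    by (subst (1) pm_expand[of p]) (simp only: sum_distrib_right)
  also have "\<dots> = pscale c p"
    by (subst (3) pm_expand[of p]) (simp add: mult_single pm.scale_sum_right mult.commute)
  finally show ?thesis
    by (metis mult.assoc pscale_eq_times)
qed

lemma pscale_times:
  fixes p q :: "'a::monoid_add \<Rightarrow>\<^sub>0 rat"
  shows "pscale c p * q = pscale c (p * q)"
  by (simp add: pscale_eq_times mult.assoc)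

lemma pm_linear_times_left: "pm_linear (\<lambda>p. p * (q :: 'a::monoid_add \<Rightarrow>\<^sub>0 rat))"
  and pm_linear_times_right: "pm_linear (\<lambda>q. (p :: 'a::monoid_add \<Rightarrow>\<^sub>0 rat) * q)"
  by (rule pm_linearI; simp add: distrib_left distrib_right pscale_times times_pscale)+

lemma pm_linear_tensor_left: "pm_linear (\<lambda>a. tensor a h)"
  and pm_linear_tensor_right: "pm_linear (tensor a)"
  by (rule pm_linearI; simp add: tensor_bilinear)+

text \<open>Meant for the linearity of \<open>p(\<partial>) f\<close> in \<open>f\<close>, where the
  argument enters through the prescribed values and not through the polynomial that is
  expanded.\<close>

lemma pm_linear_extend_weights: "pm_linear (\<lambda>f. pm_extend (\<lambda>a. g a f) p)"
  if "\<And>a. pm_linear (g a)"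
  by (rule pm_linearI)
    (simp_all add: pm_extend_def pm_linear_add[OF that] pm_linear_pscale[OF that]
      pm.scale_right_distrib sum.distrib pm.scale_sum_right mult.commute)

lemma tensor_single [simp]:
  "tensor (Poly_Mapping.single w c) (Poly_Mapping.single m d) = Poly_Mapping.single (w, m) (c * d)"
  by (simp add: tensor_def)

text \<open>Besides membership this also proves equations on a span, by taking
  \<open>V = {0}\<close>.\<close>

lemma pm_linear_image_in_span:
  assumes "pm_linear f" "\<And>x. x \<in> S \<Longrightarrow> f x \<in> V" "pm.subspace V" "x \<in> pm.span S"
  shows "f x \<in> V"
  using assms(4)
proof (induction rule: pm.span_induct_alt)
  case base
  then show ?case by (simp add: pm_linear_0 assms pm.subspace_0)
next
  case (step c x y)
  then show ?case
    by (simp add: pm_linear_add pm_linear_pscale assms pm.subspace_add pm.subspace_scale)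
qed

lemma pm_linear_diff_fun: "pm_linear f \<Longrightarrow> pm_linear g \<Longrightarrow> pm_linear (\<lambda>p. f p - g p)"
  by (rule pm_linearI) (simp_all add: pm_linear_add pm_linear_pscale pm.scale_right_diff_distrib)

lemma pm_linear_0_fun: "pm_linear (\<lambda>p. 0)"
  by (rule pm_linearI) simp_all

lemma pm_linear_subspace_vimage: "pm_linear f \<Longrightarrow> pm.subspace V \<Longrightarrow> pm.subspace {x. f x \<in> V}"
  by (auto simp: pm.subspace_def pm_linear_add pm_linear_pscale pm_linear_0)

lemma tensor_in_tensor_space: "tensor a h \<in> tensor_space V W" if "a \<in> V" "h \<in> W"
  unfolding tensor_space_def using that by (auto intro: pm.span_base)

lemma subspace_tensor_space: "pm.subspace (tensor_space V W)"
  by (simp add: tensor_space_def)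



section \<open>Slices of tensors\<close>

text \<open>Contraction of the right factor against the coefficient functional at \<open>m\<close>.
  It sends a pure tensor to a multiple of its left factor, so columns see the left space and rows
  the right one.\<close>

definition tensor_col :: "'b \<Rightarrow> ('a \<times> 'b \<Rightarrow>\<^sub>0 rat) \<Rightarrow> ('a \<Rightarrow>\<^sub>0 rat)" where
  "tensor_col m = pm_extend (\<lambda>(w, m'). if m' = m then Poly_Mapping.single w 1 else 0)"

definition tensor_row :: "'a \<Rightarrow> ('a \<times> 'b \<Rightarrow>\<^sub>0 rat) \<Rightarrow> ('b \<Rightarrow>\<^sub>0 rat)" where
  "tensor_row w = pm_extend (\<lambda>(w', m). if w' = w then Poly_Mapping.single m 1 else 0)"

lemma lookup_pm_extend:
  "Poly_Mapping.lookup (pm_extend f p) b =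
    (\<Sum>a\<in>Poly_Mapping.keys p. Poly_Mapping.lookup p a * Poly_Mapping.lookup (f a) b)"
  by (simp add: pm_extend_def lookup_sum)

lemma lookup_tensor_col [simp]:
  "Poly_Mapping.lookup (tensor_col m t) w = Poly_Mapping.lookup t (w, m)"
proof -
  have "Poly_Mapping.lookup (tensor_col m t) w =
      (\<Sum>a\<in>Poly_Mapping.keys t. if a = (w, m) then Poly_Mapping.lookup t (w, m) else 0)"
    unfolding tensor_col_def lookup_pm_extend
    by (rule sum.cong) (auto simp: lookup_single when_def split: if_splits)
  then show ?thesis
    by (simp add: sum.delta' in_keys_iff)
qed

lemma lookup_tensor_row [simp]:
  "Poly_Mapping.lookup (tensor_row w t) m = Poly_Mapping.lookup t (w, m)"
proof -
  have "Poly_Mapping.lookup (tensor_row w t) m =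
      (\<Sum>a\<in>Poly_Mapping.keys t. if a = (w, m) then Poly_Mapping.lookup t (w, m) else 0)"
    unfolding tensor_row_def lookup_pm_extend
    by (rule sum.cong) (auto simp: lookup_single when_def split: if_splits)
  then show ?thesis
    by (simp add: sum.delta' in_keys_iff)
qed

lemma pm_linear_tensor_col: "pm_linear (tensor_col m)"
  and pm_linear_tensor_row: "pm_linear (tensor_row w)"
  unfolding tensor_col_def tensor_row_def by (rule linear_pm_extend)+

lemma tensor_col_tensor: "tensor_col m (tensor a h) = pscale (Poly_Mapping.lookup h m) a"
  and tensor_row_tensor: "tensor_row w (tensor a h) = pscale (Poly_Mapping.lookup a w) h"
  by (rule poly_mapping_eqI; simp add: lookup_tensor)+

lemma sum_tensor_col:
  assumes "finite M" "snd ` Poly_Mapping.keys t \<subseteq> M"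
  shows "t = (\<Sum>m\<in>M. tensor (tensor_col m t) (Poly_Mapping.single m 1))"
proof (rule poly_mapping_eqI, clarify)
  fix w m
  have "Poly_Mapping.lookup t (w, m) = 0" if "m \<notin> M"
    using that assms(2) by (force simp: in_keys_iff)
  then show "Poly_Mapping.lookup t (w, m) = Poly_Mapping.lookup
      (\<Sum>m\<in>M. tensor (tensor_col m t) (Poly_Mapping.single m 1)) (w, m)"
    using assms(1) by (auto simp: lookup_sum lookup_tensor lookup_single when_def
        if_distrib[of "(*) _"] sum.delta' cong: if_cong)
qed

lemma sum_tensor_row:
  assumes "finite M" "fst ` Poly_Mapping.keys t \<subseteq> M"
  shows "t = (\<Sum>w\<in>M. tensor (Poly_Mapping.single w 1) (tensor_row w t))"
proof (rule poly_mapping_eqI, clarify)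
  fix w m
  have "Poly_Mapping.lookup t (w, m) = 0" if "w \<notin> M"
    using that assms(2) by (force simp: in_keys_iff)
  then show "Poly_Mapping.lookup t (w, m) = Poly_Mapping.lookup
      (\<Sum>w\<in>M. tensor (Poly_Mapping.single w 1) (tensor_row w t)) (w, m)"
    using assms(1) by (auto simp: lookup_sum lookup_tensor lookup_single when_def
        if_distrib[of "\<lambda>x. x * _"] sum.delta' cong: if_cong)
qed

lemma tensor_col_in:
  assumes "pm.subspace V" "t \<in> tensor_space V W"
  shows "tensor_col m t \<in> V"
proof (rule pm_linear_image_in_span[OF pm_linear_tensor_col _ assms(1)
      assms(2)[unfolded tensor_space_def]])
  fix x assume "x \<in> {tensor a h |a h. a \<in> V \<and> h \<in> W}"
  then show "tensor_col m x \<in> V"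
    using assms(1) by (auto simp: tensor_col_tensor pm.subspace_scale)
qed

text \<open>Apply \<open>\<pi> \<otimes> 1\<close>, with \<open>\<pi>\<close> a linear projection onto \<open>V\<close>, to the row expansion of \<open>t\<close>.\<close>

lemma in_tensor_space_slices:
  assumes V: "pm.subspace V" and cols: "\<And>m. tensor_col m t \<in> V" and rows: "\<And>w. tensor_row w t \<in> W"
  shows "t \<in> tensor_space V W"
proof -
  interpret vs: vector_space_pair pscale pscale by unfold_locales
  \<comment> \<open>A linear left inverse of the identity on \<open>V\<close> with values in
    \<open>V\<close> is a projection onto \<open>V\<close>.\<close>
  obtain \<pi> :: "('a \<Rightarrow>\<^sub>0 rat) \<Rightarrow> ('a \<Rightarrow>\<^sub>0 rat)"
    where \<pi>: "range \<pi> \<subseteq> V" "pm_linear \<pi>" "\<And>v. v \<in> V \<Longrightarrow> \<pi> v = v"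
    using vs.linear_exists_left_inverse_on[OF pm_linear_id V] by (auto simp: inj_on_def)
  define M where "M = snd ` Poly_Mapping.keys t"
  define N where "N = fst ` Poly_Mapping.keys t"
  have fin: "finite M" "finite N" by (auto simp: M_def N_def)
  have "t = (\<Sum>m\<in>M. tensor (tensor_col m t) (Poly_Mapping.single m 1))"
    by (rule sum_tensor_col) (auto simp: M_def)
  also have "\<dots> = (\<Sum>m\<in>M. tensor (\<pi> (tensor_col m t)) (Poly_Mapping.single m 1))"
    by (simp add: \<pi> cols)
  also have "\<dots> = (\<Sum>w\<in>N. tensor (\<pi> (Poly_Mapping.single w 1)) (tensor_row w t))"
  proof -
    \<comment> \<open>Both sides expand to the double sum of \<open>t(w, m)\<close> times
      \<open>\<pi> w \<otimes> m\<close>.\<close>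
    have "tensor_col m t = (\<Sum>w\<in>N. pscale (Poly_Mapping.lookup t (w, m)) (Poly_Mapping.single w 1))" for m
      by (subst sum_tensor_row[of N t])
        (simp_all add: fin N_def pm_linear_sum[OF pm_linear_tensor_col] tensor_col_tensor del: pscale_single)
    moreover have "tensor_row w t = (\<Sum>m\<in>M. pscale (Poly_Mapping.lookup t (w, m)) (Poly_Mapping.single m 1))" for w
      by (subst sum_tensor_col[of M t])
        (simp_all add: fin M_def pm_linear_sum[OF pm_linear_tensor_row] tensor_row_tensor del: pscale_single)
    ultimately show ?thesis
      by (simp add: pm_linear_sum[OF \<pi>(2)] pm_linear_pscale[OF \<pi>(2)]
          pm_linear_sum[OF pm_linear_tensor_left] pm_linear_sum[OF pm_linear_tensor_right]
          tensor_bilinear del: pscale_single) (rule sum.swap)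
  qed
  also have "\<dots> \<in> tensor_space V W"
    using \<pi>(1) rows by (intro pm.subspace_sum subspace_tensor_space tensor_in_tensor_space) auto
  finally show ?thesis .
qed


section \<open>The Hausdorff derivative is a derivation\<close>

lemma one_ncpoly: "(1 :: 'n ncpoly) = Poly_Mapping.single [] 1"
  by (simp add: single_one[symmetric] zero_list_def del: single_one)

lemma single_times_single [simp]:
  "Poly_Mapping.single u c * Poly_Mapping.single v d = (Poly_Mapping.single (u @ v) (c * d) :: 'n ncpoly)"
  by (simp add: mult_single plus_list_def)

lemma single_Nil_times [simp]: "Poly_Mapping.single [] c * p = pscale c (p :: 'n ncpoly)"
  and times_single_Nil [simp]: "p * Poly_Mapping.single [] c = pscale c (p :: 'n ncpoly)"
proof -
  have *: "Poly_Mapping.single [] c = pscale c (1 :: 'n ncpoly)"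
    by (simp add: one_ncpoly)
  show "Poly_Mapping.single [] c * p = pscale c p" "p * Poly_Mapping.single [] c = pscale c p"
    by (simp_all add: * pscale_times times_pscale)
qed

lemma pm_linear_hausdorff_deriv: "pm_linear (hausdorff_deriv i)"
  unfolding hausdorff_deriv_def by (rule linear_pm_extend)

lemma hausdorff_deriv_single:
  "hausdorff_deriv i (Poly_Mapping.single w 1) =
    (\<Sum>k | k < length w \<and> w ! k = i. Poly_Mapping.single (take k w @ drop (Suc k) w) 1)"
  by (simp add: hausdorff_deriv_def)

lemma hausdorff_deriv_Nil [simp]: "hausdorff_deriv i (Poly_Mapping.single [] c) = 0"
  by (simp add: hausdorff_deriv_def)

text \<open>Position 0 is separated from the positions inside \<open>w\<close>. This is the Leibniz
  rule for a leading letter, and the general rule follows by induction on the first factor.\<close>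

lemma hausdorff_deriv_Cons:
  "hausdorff_deriv i (Poly_Mapping.single (j # w) 1) =
    (if j = i then Poly_Mapping.single w 1 else 0) +
    Poly_Mapping.single [j] 1 * hausdorff_deriv i (Poly_Mapping.single w 1)"
proof -
  let ?K = "{k. k < length w \<and> w ! k = i}"
  let ?f = "\<lambda>k. Poly_Mapping.single (take k (j # w) @ drop (Suc k) (j # w)) (1 :: rat)"
  have "{k. k < length (j # w) \<and> (j # w) ! k = i} = (if j = i then {0} else {}) \<union> Suc ` ?K"
    by (auto simp: image_iff gr0_conv_Suc nth_Cons split: nat.splits) (metis not0_implies_Suc)
  then have "hausdorff_deriv i (Poly_Mapping.single (j # w) 1) =
      (\<Sum>k\<in>(if j = i then {0} else {}). ?f k) + (\<Sum>k\<in>Suc ` ?K. ?f k)"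
    unfolding hausdorff_deriv_single by (simp only:) (rule sum.union_disjoint; auto)
  also have "(\<Sum>k\<in>Suc ` ?K. ?f k) = Poly_Mapping.single [j] 1 * hausdorff_deriv i (Poly_Mapping.single w 1)"
    unfolding hausdorff_deriv_single by (simp add: sum.reindex sum_distrib_left)
  finally show ?thesis by simp
qed

lemma hausdorff_deriv_var_times:
  "hausdorff_deriv i (Poly_Mapping.single [j] 1 * q) =
    (if j = i then q else 0) + Poly_Mapping.single [j] 1 * hausdorff_deriv i q"
proof (rule pm_linear_eqI[of "\<lambda>q. hausdorff_deriv i (Poly_Mapping.single [j] 1 * q)"])
  show "pm_linear (\<lambda>q. (if j = i then q else 0) + Poly_Mapping.single [j] 1 * hausdorff_deriv i q)"
    by (cases "j = i") (auto intro!: pm_linear_plus pm_linear_comp[OF pm_linear_times_right]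
        pm_linear_hausdorff_deriv pm_linear_id pm_linear_0_fun)
qed (auto intro!: pm_linear_comp[OF pm_linear_hausdorff_deriv] pm_linear_times_right
      simp: hausdorff_deriv_Cons)

lemma hausdorff_deriv_times:
  "hausdorff_deriv i (p * q) = hausdorff_deriv i p * q + p * hausdorff_deriv i q"
proof (rule pm_linear_eqI[of "\<lambda>p. hausdorff_deriv i (p * q)"])
  fix u
  show "hausdorff_deriv i (Poly_Mapping.single u 1 * q) =
      hausdorff_deriv i (Poly_Mapping.single u 1) * q + Poly_Mapping.single u 1 * hausdorff_deriv i q"
  proof (induction u)
    case (Cons j u)
    have "Poly_Mapping.single (j # u) 1 = (Poly_Mapping.single [j] 1 * Poly_Mapping.single u 1 :: 'a ncpoly)"
      by simp
    then show ?case
      using Cons by (simp add: mult.assoc hausdorff_deriv_var_times distrib_left distrib_right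
          del: single_times_single)
  qed simp
qed (intro pm_linear_comp[OF pm_linear_hausdorff_deriv] pm_linear_plus pm_linear_times_left
    pm_linear_comp[OF pm_linear_times_left] pm_linear_hausdorff_deriv)+


section \<open>The enveloping algebra of the derived free Lie algebra\<close>

lemma free_lie_minimal:
  "pm.subspace L \<Longrightarrow> (\<And>i. nc_var i \<in> L) \<Longrightarrow> (\<And>a b. a \<in> L \<Longrightarrow> b \<in> L \<Longrightarrow> lie_bracket a b \<in> L)
    \<Longrightarrow> free_lie \<subseteq> L"
  unfolding free_lie_def by (rule Inter_lower) blast

lemma nc_var_in_free_lie: "nc_var i \<in> free_lie"
  and lie_bracket_in_free_lie: "a \<in> free_lie \<Longrightarrow> b \<in> free_lie \<Longrightarrow> lie_bracket a b \<in> free_lie"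
  and subspace_free_lie: "pm.subspace free_lie"
  unfolding free_lie_def by (auto intro: pm.subspace_Inter)

lemma derived_free_lie_subset: "derived_free_lie \<subseteq> free_lie"
  unfolding derived_free_lie_def
  by (rule pm.span_minimal) (auto intro: lie_bracket_in_free_lie subspace_free_lie)

lemma lie_bracket_in_derived:
  "a \<in> free_lie \<Longrightarrow> b \<in> free_lie \<Longrightarrow> lie_bracket a b \<in> derived_free_lie"
  unfolding derived_free_lie_def by (auto intro: pm.span_base)

lemma env_derived_minimal:
  "pm.subspace A \<Longrightarrow> 1 \<in> A \<Longrightarrow> (\<And>a b. a \<in> A \<Longrightarrow> b \<in> A \<Longrightarrow> a * b \<in> A) \<Longrightarrow>
    derived_free_lie \<subseteq> A \<Longrightarrow> env_derived \<subseteq> A"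
  unfolding env_derived_def by (rule Inter_lower) blast

lemma subspace_env_derived: "pm.subspace env_derived"
  and one_in_env_derived: "1 \<in> env_derived"
  and times_in_env_derived: "a \<in> env_derived \<Longrightarrow> b \<in> env_derived \<Longrightarrow> a * b \<in> env_derived"
  and derived_subset_env_derived: "derived_free_lie \<subseteq> env_derived"
  unfolding env_derived_def by (auto intro: pm.subspace_Inter)

lemma pm_linear_lie_bracket: "pm_linear (lie_bracket a)"
  unfolding lie_bracket_def
  by (intro pm_linear_diff_fun pm_linear_times_left pm_linear_times_right)+

text \<open>Bracketing with \<open>x_i\<close> is a derivation that maps \<L>' into itself, so it
  preserves the algebra generated by \<L>'. It lets a letter move across an element of \<A>' at the
  cost of another such element.\<close>

lemma lie_bracket_var_env_derived:
  assumes "a \<in> env_derived"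
  shows "lie_bracket (nc_var i) a \<in> env_derived"
proof -
  \<comment> \<open>The product rule multiplies brackets by the elements themselves, so closure
    under products requires these to lie in \<A>' too.\<close>
  let ?A = "{a. lie_bracket (nc_var i) a \<in> env_derived} \<inter> env_derived"
  have "env_derived \<subseteq> ?A"
  proof (rule env_derived_minimal)
    show "pm.subspace ?A"
      by (intro pm.subspace_inter pm_linear_subspace_vimage pm_linear_lie_bracket subspace_env_derived)
    show "1 \<in> ?A"
      by (simp add: lie_bracket_def one_in_env_derived pm.subspace_0[OF subspace_env_derived])
    show "a * b \<in> ?A" if "a \<in> ?A" "b \<in> ?A" for a b
    proof -
      have "lie_bracket (nc_var i) (a * b) = lie_bracket (nc_var i) a * b + a * lie_bracket (nc_var i) b"
        by (simp add: lie_bracket_def algebra_simps)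
      then show ?thesis
        using that by (auto intro!: pm.subspace_add[OF subspace_env_derived] times_in_env_derived)
    qed
    show "derived_free_lie \<subseteq> ?A"
      using derived_subset_env_derived derived_free_lie_subset
      by (auto intro!: lie_bracket_in_derived nc_var_in_free_lie)
  qed
  with assms show ?thesis by auto
qed

text \<open>A letter has derivative 0 or 1, and if the derivatives of \<open>a\<close> and
  \<open>b\<close> are scalars, hence central, the derivative of their bracket cancels.\<close>

lemma hausdorff_deriv_free_lie:
  assumes "a \<in> free_lie"
  shows "hausdorff_deriv i a \<in> range (Poly_Mapping.single [])"
proof -
  let ?L = "{a. hausdorff_deriv i a \<in> range (Poly_Mapping.single [])}"
  have "free_lie \<subseteq> ?L"
  proof (rule free_lie_minimal)
    have "pm.subspace (range (Poly_Mapping.single ([] :: 'a list)))"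
      unfolding pm.subspace_def by (auto simp: single_add[symmetric] intro: range_eqI[of _ _ 0])
    then show "pm.subspace ?L"
      by (rule pm_linear_subspace_vimage[OF pm_linear_hausdorff_deriv])
    show "nc_var j \<in> ?L" for j
      by (auto simp: nc_var_def hausdorff_deriv_Cons intro: range_eqI[of _ _ 0])
    show "lie_bracket a b \<in> ?L" if "a \<in> ?L" "b \<in> ?L" for a b
      using that by (auto simp: lie_bracket_def pm_linear_diff[OF pm_linear_hausdorff_deriv]
          hausdorff_deriv_times intro: range_eqI[of _ _ 0])
  qed
  with assms show ?thesis by auto
qed

text \<open>The same cancellation kills the generators of \<L>', and the kernel of a derivation is a
  unital subalgebra.\<close>

lemma hausdorff_deriv_env_derived:
  assumes "a \<in> env_derived"
  shows "hausdorff_deriv i a = 0"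
proof -
  let ?A = "{a. hausdorff_deriv i a \<in> {0}}"
  have sub: "pm.subspace ?A"
    by (rule pm_linear_subspace_vimage[OF pm_linear_hausdorff_deriv pm.subspace_single_0])
  have "derived_free_lie \<subseteq> ?A"
    unfolding derived_free_lie_def
  proof (rule pm.span_minimal[OF subsetI sub])
    fix x :: "'a ncpoly" assume "x \<in> {lie_bracket a b |a b. a \<in> free_lie \<and> b \<in> free_lie}"
    then obtain a b where x: "x = lie_bracket a b" "a \<in> free_lie" "b \<in> free_lie" by auto
    obtain c d where "hausdorff_deriv i a = Poly_Mapping.single [] c"
      "hausdorff_deriv i b = Poly_Mapping.single [] d"
      using hausdorff_deriv_free_lie[OF x(2), of i] hausdorff_deriv_free_lie[OF x(3), of i]
      by (elim rangeE)
    then show "x \<in> ?A"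
      by (simp add: x(1) lie_bracket_def pm_linear_diff[OF pm_linear_hausdorff_deriv] hausdorff_deriv_times)
  qed
  then have "env_derived \<subseteq> ?A"
    by (rule env_derived_minimal[OF sub, rotated 2]) (simp_all add: one_ncpoly hausdorff_deriv_times)
  with assms show ?thesis by auto
qed

lemma foldr_hausdorff_deriv_env_derived:
  assumes "a \<in> env_derived"
  shows "foldr hausdorff_deriv w (a * p) = a * foldr hausdorff_deriv w p"
  by (induction w) (simp_all add: hausdorff_deriv_times hausdorff_deriv_env_derived assms)


section \<open>Symmetrisation\<close>

text \<open>The Parikh vector of the word, that is, the exponent vector of its commutative
  image.\<close>

definition content :: "'n list \<Rightarrow> ('n \<Rightarrow>\<^sub>0 nat)" where
  "content w = (\<Sum>i\<leftarrow>w. Poly_Mapping.single i 1)"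

lemma content_simps [simp]:
  "content [] = 0" "content (i # w) = Poly_Mapping.single i 1 + content w"
  "content (u @ v) = content u + content v"
  by (simp_all add: content_def)

lemma lookup_content [simp]: "Poly_Mapping.lookup (content w) i = count_list w i"
  by (induction w) (auto simp: lookup_add lookup_single)

lemma length_content:
  "content w = m \<Longrightarrow> length w = (\<Sum>i\<in>UNIV. Poly_Mapping.lookup m (i :: 'n::finite))"
  by (auto simp: sum_count_set[of w UNIV])

lemma finite_content [simp]: "finite {w :: 'n::finite list. content w = m}"
  by (rule finite_subset[OF _ finite_lists_length_eq[of UNIV "\<Sum>i\<in>UNIV. Poly_Mapping.lookup m i"]])
    (auto simp: length_content)

text \<open>Operators indexed by a monomial can thus be studied along a word representing it;
  moreover \<open>num_words\<close> is positive and may be divided by.\<close>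

lemma ex_content: "\<exists>w. content w = (m :: 'n::finite \<Rightarrow>\<^sub>0 nat)"
proof (induction "\<Sum>i\<in>UNIV. Poly_Mapping.lookup m i" arbitrary: m)
  case 0
  then have "m = 0" by (intro poly_mapping_eqI) auto
  then show ?case by (intro exI[of _ "[]"]) simp
next
  case (Suc n)
  then obtain i where "Poly_Mapping.lookup m i \<noteq> 0"
    by (metis nat.distinct(1) sum.neutral)
  then have m: "Poly_Mapping.single i 1 + (m - Poly_Mapping.single i 1) = m"
    by (intro poly_mapping_eqI) (auto simp: lookup_add lookup_minus lookup_single when_def)
  have "(\<Sum>j\<in>UNIV. Poly_Mapping.lookup m j) =
      Suc (\<Sum>j\<in>UNIV. Poly_Mapping.lookup (m - Poly_Mapping.single i 1) j)"
  proof -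
    have "(\<Sum>j\<in>UNIV. Poly_Mapping.lookup m j) =
        (\<Sum>j\<in>UNIV. Poly_Mapping.lookup (Poly_Mapping.single i 1 + (m - Poly_Mapping.single i 1)) j)"
      by (simp only: m)
    then show ?thesis
      by (simp only: lookup_add sum.distrib) (simp add: lookup_single when_def)
  qed
  with Suc obtain w where "content w = m - Poly_Mapping.single i 1" by auto
  with m show ?case by (metis content_simps(2))
qed

definition words_sum :: "('n::finite \<Rightarrow>\<^sub>0 nat) \<Rightarrow> 'n ncpoly" where
  "words_sum m = (\<Sum>w | content w = m. Poly_Mapping.single w 1)"

text \<open>The multinomial coefficient of \<open>m\<close>, kept as a cardinality; its recursion is
  read off from derivatives in \<open>num_words_minus\<close>.\<close>

definition num_words :: "('n::finite \<Rightarrow>\<^sub>0 nat) \<Rightarrow> nat" where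
  "num_words m = card {w. content w = m}"

lemma num_words_pos: "num_words m > 0"
  unfolding num_words_def using ex_content[of m] by (auto simp: card_gt_0_iff)

text \<open>The usual symmetrisation: all \<open>|m|!\<close> rearrangements hit each word of
  content \<open>m\<close> equally often, so their average is the average over the distinct
  words.\<close>

definition symz :: "'n::finite cpoly \<Rightarrow> 'n ncpoly" where
  "symz = pm_extend (\<lambda>m. pscale (1 / of_nat (num_words m)) (words_sum m))"

lemma pm_linear_symz: "pm_linear symz"
  unfolding symz_def by (rule linear_pm_extend)

lemma symz_single: "symz (Poly_Mapping.single m 1) = pscale (1 / of_nat (num_words m)) (words_sum m)"
  by (simp add: symz_def)

lemma sum_const_pscale: "(\<Sum>x\<in>A. p) = pscale (of_nat (card A)) p"
  by (rule poly_mapping_eqI) (simp add: lookup_sum[of _ A])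

text \<open>A word of content \<open>m\<close> with a marked letter \<open>i\<close> is the same as a word of content \<open>m - i\<close> with
  one of its \<open>|m|\<close> insertion points marked.\<close>

lemma hausdorff_deriv_words_sum:
  assumes "Poly_Mapping.lookup m i \<noteq> 0"
  shows "hausdorff_deriv i (words_sum m) =
    pscale (of_nat (\<Sum>j\<in>UNIV. Poly_Mapping.lookup m j)) (words_sum (m - Poly_Mapping.single i 1))"
proof -
  define m' where "m' = m - Poly_Mapping.single i 1"
  define d where "d = (\<Sum>j\<in>UNIV. Poly_Mapping.lookup m' j)"
  have m: "m = Poly_Mapping.single i 1 + m'"
    unfolding m'_def using assms
    by (intro poly_mapping_eqI) (auto simp: lookup_add lookup_minus lookup_single when_def)
  have d: "(\<Sum>j\<in>UNIV. Poly_Mapping.lookup m j) = Suc d"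
    unfolding m d_def by (simp only: lookup_add sum.distrib) (simp add: lookup_single when_def)
  have len: "length v = d" if "content v = m'" for v
    using length_content[OF that] by (simp add: d_def)
  have split: "w = take k w @ w ! k # drop (Suc k) w" if "k < length w" for k and w :: "'a list"
    using that by (simp add: id_take_nth_drop)
  have "hausdorff_deriv i (words_sum m) =
      (\<Sum>(w, k)\<in>Sigma {w. content w = m} (\<lambda>w. {k. k < length w \<and> w ! k = i}).
        Poly_Mapping.single (take k w @ drop (Suc k) w) 1)"
    unfolding words_sum_def pm_linear_sum[OF pm_linear_hausdorff_deriv] hausdorff_deriv_single
    by (subst sum.Sigma) auto
  \<comment> \<open>A word of length \<open>d\<close> has \<open>d + 1 = |m|\<close> insertion
    points, hence the range \<open>{..d}\<close>.\<close>
  also have "\<dots> = (\<Sum>(v, k)\<in>{v. content v = m'} \<times> {..d}. Poly_Mapping.single v 1)"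
  proof (rule sum.reindex_bij_witness[of _ "\<lambda>(v, k). (take k v @ i # drop k v, k)"
        "\<lambda>(w, k). (take k w @ drop (Suc k) w, k)"], goal_cases)
    case (1 x)
    then show ?case using split[of "snd x" "fst x"] by auto
  next
    case (2 x)
    then obtain w k where x: "x = (w, k)" "content w = m" "k < length w" "w ! k = i" by auto
    have "content (take k w @ drop (Suc k) w) = m'"
    proof -
      have "content w = Poly_Mapping.single i 1 + content (take k w @ drop (Suc k) w)"
        by (subst split[OF x(3)]) (simp add: x(4) ac_simps)
      then show ?thesis using x(2) m by simp
    qed
    moreover have "k \<le> d" using x length_content[OF x(2)] d by auto
    ultimately show ?case by (simp add: x)
  next
    case (3 x)
    then obtain v k where x: "x = (v, k)" "content v = m'" "k \<le> length v"
      by (cases x) (auto simp: len)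
    then show ?case by simp
  next
    case (4 x)
    then obtain v k where x: "x = (v, k)" "content v = m'" "k \<le> length v"
      by (cases x) (auto simp: len)
    have "content (take k v @ i # drop k v) =
        Poly_Mapping.single i 1 + content (take k v @ drop k v)"
      by (simp only: content_simps ac_simps)
    then show ?case using x by (simp add: m nth_append del: content_simps)
  qed auto
  also have "\<dots> = (\<Sum>v | content v = m'. pscale (of_nat (Suc d)) (Poly_Mapping.single v 1))"
    by (simp only: sum.cartesian_product[symmetric] sum_const_pscale card_atMost)
  also have "\<dots> = pscale (of_nat (Suc d)) (words_sum m')"
    by (simp add: words_sum_def pm.scale_sum_right del: pscale_single)
  finally show ?thesis unfolding d m'_def .
qed


section \<open>Abelianisation\<close>

definition abel :: "'n ncpoly \<Rightarrow> 'n cpoly" where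
  "abel = pm_extend (\<lambda>w. Poly_Mapping.single (content w) 1)"

lemma pm_linear_abel: "pm_linear abel"
  unfolding abel_def by (rule linear_pm_extend)

lemma abel_single [simp]: "abel (Poly_Mapping.single w c) = Poly_Mapping.single (content w) c"
  by (simp add: abel_def)

lemma pm_linear_partial_deriv: "pm_linear (partial_deriv i)"
  unfolding partial_deriv_def by (rule linear_pm_extend)

lemma partial_deriv_single:
  "partial_deriv i (Poly_Mapping.single m c) =
    Poly_Mapping.single (m - Poly_Mapping.single i 1) (c * of_nat (Poly_Mapping.lookup m i))"
  by (simp add: partial_deriv_def)

lemma card_positions: "card {k. k < length w \<and> w ! k = i} = count_list w i"
  by (simp add: count_list_eq_length_filter length_filter_conv_card eq_commute)

text \<open>All deletions of an \<open>i\<close> from a word have the same commutative image, and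
  their number is the exponent of \<open>x_i\<close>, which is the factor in the ordinary
  derivative.\<close>

lemma abel_hausdorff_deriv: "abel (hausdorff_deriv i p) = partial_deriv i (abel p)"
proof (rule pm_linear_eqI[of "\<lambda>p. abel (hausdorff_deriv i p)"])
  fix w
  have "content (take k w @ drop (Suc k) w) = content w - Poly_Mapping.single i 1"
    if "k < length w" "w ! k = i" for k
  proof -
    have "content w = content (take k w @ w ! k # drop (Suc k) w)"
      using that(1) by (simp add: id_take_nth_drop[symmetric] del: content_simps)
    also have "\<dots> = content (take k w @ drop (Suc k) w) + Poly_Mapping.single i 1"
      by (simp only: content_simps that(2) ac_simps)
    finally show ?thesis by simp
  qed
  then have "abel (hausdorff_deriv i (Poly_Mapping.single w 1)) =
      (\<Sum>k | k < length w \<and> w ! k = i. Poly_Mapping.single (content w - Poly_Mapping.single i 1) 1)"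
    unfolding hausdorff_deriv_single pm_linear_sum[OF pm_linear_abel] abel_single
    by (intro sum.cong refl arg_cong2[where f = Poly_Mapping.single]) blast
  then show "abel (hausdorff_deriv i (Poly_Mapping.single w 1)) =
      partial_deriv i (abel (Poly_Mapping.single w 1))"
    by (simp only: sum_const_pscale card_positions partial_deriv_single abel_single lookup_content
        pscale_single mult.commute)
qed (rule pm_linear_comp[OF pm_linear_abel pm_linear_hausdorff_deriv]
    pm_linear_comp[OF pm_linear_partial_deriv pm_linear_abel])+

lemma abel_words_sum: "abel (words_sum m) = Poly_Mapping.single m (of_nat (num_words m))"
proof -
  have "abel (words_sum m) = (\<Sum>w | content w = m. Poly_Mapping.single m 1)"
    unfolding words_sum_def pm_linear_sum[OF pm_linear_abel] by (rule sum.cong) auto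
  then show ?thesis
    by (simp only: sum_const_pscale num_words_def pscale_single mult_1_right)
qed

lemma abel_symz [simp]: "abel (symz q) = q"
proof (rule pm_linear_eqI[of "\<lambda>q. abel (symz q)"])
  fix m
  show "abel (symz (Poly_Mapping.single m 1)) = Poly_Mapping.single m 1"
    using num_words_pos[of m]
    by (simp add: symz_single pm_linear_pscale[OF pm_linear_abel] abel_words_sum)
qed (rule pm_linear_comp[OF pm_linear_abel pm_linear_symz] pm_linear_id)+

text \<open>The recursion of the multinomial coefficients comes without further counting: abelianise
  \<open>hausdorff_deriv_words_sum\<close> and compare coefficients.\<close>

lemma num_words_minus:
  assumes "Poly_Mapping.lookup m i \<noteq> 0"
  shows "of_nat (num_words m) * of_nat (Poly_Mapping.lookup m i) =
    (of_nat (\<Sum>j\<in>UNIV. Poly_Mapping.lookup m j) * of_nat (num_words (m - Poly_Mapping.single i 1)) :: rat)"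
proof -
  have "partial_deriv i (abel (words_sum m)) =
      abel (pscale (of_nat (\<Sum>j\<in>UNIV. Poly_Mapping.lookup m j)) (words_sum (m - Poly_Mapping.single i 1)))"
    by (simp only: abel_hausdorff_deriv[symmetric] hausdorff_deriv_words_sum[OF assms])
  then show ?thesis
    by (simp only: abel_words_sum partial_deriv_single pm_linear_pscale[OF pm_linear_abel]
        pscale_single) (metis lookup_single_eq)
qed

text \<open>Differentiating a word sum yields the factor \<open>|m|\<close>; the normalisation by
  \<open>num_words\<close> converts it into the exponent of \<open>x_i\<close>.\<close>

lemma hausdorff_deriv_symz: "hausdorff_deriv i (symz h) = symz (partial_deriv i h)"
proof (rule pm_linear_eqI[of "\<lambda>h. hausdorff_deriv i (symz h)"])
  fix m :: "'a \<Rightarrow>\<^sub>0 nat"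
  let ?m' = "m - Poly_Mapping.single i 1"
  show "hausdorff_deriv i (symz (Poly_Mapping.single m 1)) = symz (partial_deriv i (Poly_Mapping.single m 1))"
  proof (cases "Poly_Mapping.lookup m i = 0")
    \<comment> \<open>There is no letter to delete; on the commutative side the truncated
      subtraction leaves \<open>m\<close> as it is, but with coefficient 0.\<close>
    case True
    have "hausdorff_deriv i (Poly_Mapping.single w 1) = 0" if "content w = m" for w
    proof -
      have "card {k. k < length w \<and> w ! k = i} = 0"
        unfolding card_positions using that True by (metis lookup_content)
      then have "{k. k < length w \<and> w ! k = i} = {}" by simp
      then show ?thesis by (simp only: hausdorff_deriv_single sum.empty)
    qed
    then have "hausdorff_deriv i (words_sum m) = 0"
      unfolding words_sum_def pm_linear_sum[OF pm_linear_hausdorff_deriv] by (intro sum.neutral) simp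
    then show ?thesis
      using True by (simp add: symz_single partial_deriv_single pm_linear_0[OF pm_linear_symz]
          pm_linear_pscale[OF pm_linear_hausdorff_deriv])
  next
    case False
    have "hausdorff_deriv i (symz (Poly_Mapping.single m 1)) =
        pscale (1 / of_nat (num_words m) * of_nat (\<Sum>j\<in>UNIV. Poly_Mapping.lookup m j)) (words_sum ?m')"
      by (simp only: symz_single pm_linear_pscale[OF pm_linear_hausdorff_deriv]
          hausdorff_deriv_words_sum[OF False] pm.scale_scale)
    also have "1 / of_nat (num_words m) * of_nat (\<Sum>j\<in>UNIV. Poly_Mapping.lookup m j) =
        (of_nat (Poly_Mapping.lookup m i) / of_nat (num_words ?m') :: rat)"
      using num_words_minus[OF False] num_words_pos[of m] num_words_pos[of ?m']
      by (simp add: field_simps del: of_nat_sum)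
    also have "pscale \<dots> (words_sum ?m') = symz (pscale (of_nat (Poly_Mapping.lookup m i)) (Poly_Mapping.single ?m' 1))"
      by (simp only: pm_linear_pscale[OF pm_linear_symz] symz_single pm.scale_scale) simp
    finally show ?thesis
      by (simp only: partial_deriv_single pscale_single mult.commute)
  qed
qed (rule pm_linear_comp[OF pm_linear_hausdorff_deriv pm_linear_symz]
    pm_linear_comp[OF pm_linear_symz pm_linear_partial_deriv])+

section \<open>Differential operators along a word and their commutative images\<close>

lemma foldr_hausdorff_deriv_symz:
  "foldr hausdorff_deriv w (symz h) = symz (foldr partial_deriv w h)"
  by (induction w) (simp_all add: hausdorff_deriv_symz)

text \<open>The partial derivatives commute, so the fold may treat the variable \<open>j\<close>
  last; one more letter \<open>j\<close> is then one more outermost application of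
  \<open>partial_deriv j\<close>.\<close>

lemma fold_partial_deriv_content:
  "Finite_Set.fold (\<lambda>i. partial_deriv i ^^ Poly_Mapping.lookup (content w) i) h UNIV =
    foldr partial_deriv w (h :: 'n::finite cpoly)"
proof (induction w)
  case Nil
  interpret comp_fun_commute_on UNIV "\<lambda>(i :: 'n) h :: 'n cpoly. h"
    by standard auto
  have "Finite_Set.fold (\<lambda>(i :: 'n) h. h) h A = h" for A
    by (induction A rule: infinite_finite_induct) simp_all
  then show ?case by simp
next
  case (Cons j w)
  let ?f = "\<lambda>w i. partial_deriv i ^^ Poly_Mapping.lookup (content w) i"
  have comm: "comp_fun_commute_on UNIV (?f w)" for w :: "'n list"
    by (rule comp_fun_commute_partial_deriv)
  have rec: "Finite_Set.fold (?f w) h UNIV = ?f w j (Finite_Set.fold (?f w) h (UNIV - {j}))" for w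
    by (rule comp_fun_commute_on.fold_rec[OF comm]) auto
  have "Finite_Set.fold (?f (j # w)) h (UNIV - {j}) = Finite_Set.fold (?f w) h (UNIV - {j})"
    by (rule Finite_Set.fold_cong[OF comm comm]) (auto simp del: content_simps)
  then have "Finite_Set.fold (?f (j # w)) h UNIV = partial_deriv j (Finite_Set.fold (?f w) h UNIV)"
    by (subst (1 2) rec) (simp del: content_simps)
  with Cons show ?case by simp
qed

lemma c_diff_content:
  "c_diff (Poly_Mapping.single (content w) 1) h = foldr partial_deriv w h"
  by (simp add: c_diff_def fold_partial_deriv_content del: lookup_content)

lemma pm_linear_foldr: "(\<And>i. pm_linear (f i)) \<Longrightarrow> pm_linear (foldr f w)"
  by (induction w) (simp_all add: o_def id_def pm_linear_id pm_linear_comp)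

lemma pm_linear_c_diff: "pm_linear (c_diff q)" "pm_linear (\<lambda>q. c_diff q h)"
proof -
  show "pm_linear (c_diff q)"
    unfolding c_diff_def
  proof (rule pm_linear_extend_weights)
    fix m :: "'a \<Rightarrow>\<^sub>0 nat"
    \<comment> \<open>Along a word the operator is a plain composition of linear maps.\<close>
    obtain w where w: "m = content w" using ex_content by metis
    show "pm_linear (\<lambda>h. Finite_Set.fold (\<lambda>i. partial_deriv i ^^ Poly_Mapping.lookup m i) h UNIV)"
      unfolding w fold_partial_deriv_content by (intro pm_linear_foldr pm_linear_partial_deriv)
  qed
  show "pm_linear (\<lambda>q. c_diff q h)"
    unfolding c_diff_def by (rule linear_pm_extend)
qed

lemma pm_linear_nc_diff: "pm_linear (nc_diff p)" "pm_linear (\<lambda>p. nc_diff p f)"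
  unfolding nc_diff_def
  by (intro pm_linear_extend_weights pm_linear_foldr pm_linear_hausdorff_deriv linear_pm_extend)+

text \<open>Each derivative passes over \<open>a\<close>, which it kills, and through
  \<open>symz\<close>, where it becomes a partial derivative. Hence only the commutative image of
  \<open>p\<close> acts, and only on \<open>h\<close>.\<close>

lemma nc_diff_env_derived_symz:
  assumes "a \<in> env_derived"
  shows "nc_diff p (a * symz h) = a * symz (c_diff (abel p) h)"
proof (rule pm_linear_eqI[of "\<lambda>p. nc_diff p (a * symz h)"])
  show "pm_linear (\<lambda>p. a * symz (c_diff (abel p) h))"
    by (rule pm_linear_comp[OF pm_linear_times_right
          pm_linear_comp[OF pm_linear_symz pm_linear_comp[OF pm_linear_c_diff(2) pm_linear_abel]]])
next
  fix w
  have "nc_diff (Poly_Mapping.single w 1) (a * symz h) = foldr hausdorff_deriv w (a * symz h)"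
    by (simp add: nc_diff_def)
  then show "nc_diff (Poly_Mapping.single w 1) (a * symz h) =
      a * symz (c_diff (abel (Poly_Mapping.single w 1)) h)"
    by (simp add: foldr_hausdorff_deriv_env_derived[OF assms] foldr_hausdorff_deriv_symz c_diff_content)
qed (rule pm_linear_nc_diff)



section \<open>Permutation actions\<close>

lemma pm_linear_nc_perm: "pm_linear (nc_perm \<sigma>)"
  and pm_linear_c_perm: "pm_linear (c_perm \<tau>)"
  and pm_linear_diag_perm: "pm_linear (diag_perm \<tau>)"
  unfolding nc_perm_def c_perm_def diag_perm_def by (rule linear_pm_extend)+

lemma nc_perm_single [simp]:
  "nc_perm \<sigma> (Poly_Mapping.single w c) = Poly_Mapping.single (map \<sigma> w) c"
  by (simp add: nc_perm_def)

lemma nc_perm_times: "nc_perm \<sigma> (p * q) = nc_perm \<sigma> p * nc_perm \<sigma> q"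
proof (rule pm_linear_eqI[of "\<lambda>p. nc_perm \<sigma> (p * q)"])
  fix u
  show "nc_perm \<sigma> (Poly_Mapping.single u 1 * q) = nc_perm \<sigma> (Poly_Mapping.single u 1) * nc_perm \<sigma> q"
    by (rule pm_linear_eqI[of "\<lambda>q. nc_perm \<sigma> (Poly_Mapping.single u 1 * q)"])
      (simp_all add: pm_linear_comp[OF pm_linear_nc_perm pm_linear_times_right]
        pm_linear_comp[OF pm_linear_times_right pm_linear_nc_perm])
qed (rule pm_linear_comp[OF pm_linear_nc_perm pm_linear_times_left]
    pm_linear_comp[OF pm_linear_times_left pm_linear_nc_perm])+

lemma c_perm_content:
  "c_perm \<sigma> (Poly_Mapping.single (content w) c) = Poly_Mapping.single (content (map \<sigma> w)) c"
proof -
  have *: "(\<Sum>i\<in>UNIV. Poly_Mapping.single (\<sigma> i) (count_list w i)) = content (map \<sigma> w)"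
  proof (induction w)
    case (Cons j w)
    have "(\<Sum>i\<in>UNIV. Poly_Mapping.single (\<sigma> i) (count_list (j # w) i)) =
        (\<Sum>i\<in>UNIV. (if i = j then Poly_Mapping.single (\<sigma> i) 1 else 0) +
          Poly_Mapping.single (\<sigma> i) (count_list w i))"
      by (rule sum.cong) (auto simp: single_add[symmetric])
    then show ?case using Cons by (simp add: sum.distrib)
  qed simp
  show ?thesis by (simp add: c_perm_def *)
qed

lemma abel_nc_perm: "abel (nc_perm \<sigma> p) = c_perm \<sigma> (abel p)"
  by (rule pm_linear_eqI[of "\<lambda>p. abel (nc_perm \<sigma> p)"])
    (simp_all add: c_perm_content pm_linear_comp[OF pm_linear_abel pm_linear_nc_perm]
      pm_linear_comp[OF pm_linear_c_perm pm_linear_abel])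

text \<open>By \<open>c_perm_content\<close> the content of a relabelled word depends only on the
  content of the word; this is applied to \<open>\<sigma>\<close> and to its inverse.\<close>

lemma content_map_eq_iff:
  fixes \<sigma> :: "'n::finite \<Rightarrow> 'n"
  assumes "bij \<sigma>"
  shows "content (map \<sigma> u) = content (map \<sigma> v) \<longleftrightarrow> content u = content v"
proof -
  have eq: "content u = content v \<Longrightarrow> content (map \<tau> u) = content (map \<tau> v)"
 for u v :: "'n list" and \<tau> :: "'n \<Rightarrow> 'n"
    using c_perm_content[of \<tau> u 1] c_perm_content[of \<tau> v 1]
    by (metis lookup_single_eq lookup_single_not_eq zero_neq_one)
  have "map (inv \<sigma>) (map \<sigma> w) = w" for w
    using assms by (simp add: bij_is_inj)
  then have "content u = content v" if "content (map \<sigma> u) = content (map \<sigma> v)"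
    using eq[OF that, of "inv \<sigma>"] by (simp only:)
  then show ?thesis using eq by blast
qed

text \<open>Relabelling is a bijection from the words of one content onto the words of the permuted
  content, so both the word sums and the normalising counts correspond.\<close>

lemma nc_perm_symz:
  assumes "bij \<sigma>"
  shows "nc_perm \<sigma> (symz h) = symz (c_perm \<sigma> h)"
proof (rule pm_linear_eqI[of "\<lambda>h. nc_perm \<sigma> (symz h)"])
  fix m :: "'a \<Rightarrow>\<^sub>0 nat"
  obtain u where u: "m = content u" using ex_content[of m] by blast
  have inv: "map \<sigma> (map (inv \<sigma>) w) = w" "map (inv \<sigma>) (map \<sigma> w) = w" for w
    using assms by (simp_all add: bij_is_inj bij_is_surj surj_f_inv_f map_idI)
  have bij: "bij_betw (map \<sigma>) {w. content w = m} {w. content w = content (map \<sigma> u)}"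
  proof (rule bij_betw_byWitness[where f' = "map (inv \<sigma>)"])
    show "map (inv \<sigma>) ` {w. content w = content (map \<sigma> u)} \<subseteq> {w. content w = m}"
    proof clarify
      fix w assume "content w = content (map \<sigma> u)"
      then have "content (map \<sigma> (map (inv \<sigma>) w)) = content (map \<sigma> u)" by (simp only: inv)
      then show "content (map (inv \<sigma>) w) = m" by (simp only: u content_map_eq_iff[OF assms])
    qed
  qed (auto simp only: u content_map_eq_iff[OF assms] inv)
  have "nc_perm \<sigma> (words_sum m) = words_sum (content (map \<sigma> u))"
    unfolding words_sum_def pm_linear_sum[OF pm_linear_nc_perm] nc_perm_single
    by (rule sum.reindex_bij_betw[OF bij])
  moreover have "num_words m = num_words (content (map \<sigma> u))"
    unfolding num_words_def by (rule bij_betw_same_card[OF bij])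
  ultimately show "nc_perm \<sigma> (symz (Poly_Mapping.single m 1)) = symz (c_perm \<sigma> (Poly_Mapping.single m 1))"
    by (simp only: symz_single pm_linear_pscale[OF pm_linear_nc_perm]) (simp only: u c_perm_content symz_single)
qed (rule pm_linear_comp[OF pm_linear_nc_perm pm_linear_symz]
    pm_linear_comp[OF pm_linear_symz pm_linear_c_perm])+

section \<open>Symmetric polynomials without constant term under abelianisation\<close>

lemma lookup_abel_0: "Poly_Mapping.lookup (abel p) 0 = Poly_Mapping.lookup p []"
proof -
  have "content w = 0 \<longleftrightarrow> w = []" for w :: "'a list"
    by (cases w; metis content_simps(1) count_list.simps(1,2) lookup_content nat.simps(3) lookup_zero add_is_0 zero_neq_one)
  then show ?thesis
    by (auto simp: abel_def lookup_pm_extend lookup_single when_def if_distrib[of "(*) _"]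
        sum.delta in_keys_iff cong: if_cong)
qed

lemma abel_NCSym_plus:
  assumes "p \<in> NCSym_plus"
  shows "abel p \<in> c_Sym_plus"
proof -
  have "c_perm \<sigma> (abel p) = abel p" if "bij \<sigma>" for \<sigma>
    using assms that unfolding NCSym_plus_def NCSym_def by (simp flip: abel_nc_perm)
  moreover have "Poly_Mapping.lookup (abel p) 0 = 0"
    using assms unfolding lookup_abel_0 NCSym_plus_def by blast
  ultimately show ?thesis unfolding c_Sym_plus_def by blast
qed

text \<open>With \<open>abel_symz\<close> this lifts every commutative symmetric polynomial, so the
  conditions defining \<open>MHar\<close> involve all symmetric differential operators.\<close>

lemma symz_c_Sym_plus:
  assumes "q \<in> c_Sym_plus"
  shows "symz q \<in> NCSym_plus"
proof -
  have "nc_perm \<sigma> (symz q) = symz q" if "bij \<sigma>" for \<sigma>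
    using assms that unfolding c_Sym_plus_def by (simp add: nc_perm_symz)
  moreover have "Poly_Mapping.lookup (symz q) [] = 0"
    using assms lookup_abel_0[of "symz q"] unfolding c_Sym_plus_def by simp
  ultimately show ?thesis unfolding NCSym_plus_def NCSym_def by blast
qed


section \<open>The isomorphism with the tensor product\<close>

text \<open>On all pairs this is far from injective, as \<open>x_i \<otimes> 1\<close> and
  \<open>1 \<otimes> x_i\<close> have the same image; it becomes bijective once the left factor is
  restricted to \<A>'.\<close>

definition tensor_mult :: "('n::finite list \<times> ('n \<Rightarrow>\<^sub>0 nat) \<Rightarrow>\<^sub>0 rat) \<Rightarrow> 'n ncpoly" where
  "tensor_mult = pm_extend (\<lambda>(w, m). Poly_Mapping.single w 1 * symz (Poly_Mapping.single m 1))"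

lemma pm_linear_tensor_mult: "pm_linear tensor_mult"
  unfolding tensor_mult_def by (rule linear_pm_extend)

lemma pm_linear_tensor_eqI:
  assumes f: "pm_linear f" and g1: "\<And>h. pm_linear (\<lambda>a. g a h)" and g2: "\<And>a. pm_linear (g a)"
    and eq: "\<And>w m. f (Poly_Mapping.single (w, m) 1) = g (Poly_Mapping.single w 1) (Poly_Mapping.single m 1)"
  shows "f (tensor a h) = g a h"
proof (rule pm_linear_eqI[of "\<lambda>a. f (tensor a h)" "\<lambda>a. g a h"])
  fix w
  show "f (tensor (Poly_Mapping.single w 1) h) = g (Poly_Mapping.single w 1) h"
    by (rule pm_linear_eqI[of "\<lambda>h. f (tensor (Poly_Mapping.single w 1) h)"])
      (simp_all add: pm_linear_comp[OF f pm_linear_tensor_right] g2 eq)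
qed (simp_all add: pm_linear_comp[OF f pm_linear_tensor_left] g1)

lemma tensor_mult_tensor: "tensor_mult (tensor a h) = a * symz h"
  by (rule pm_linear_tensor_eqI[OF pm_linear_tensor_mult])
    (simp_all add: pm_linear_times_left pm_linear_comp[OF pm_linear_times_right pm_linear_symz]
      tensor_mult_def)

text \<open>The operator \<open>1 \<otimes> q(\<partial>)\<close>.\<close>

definition tensor_diff ::
  "'n cpoly \<Rightarrow> ('n::finite list \<times> ('n \<Rightarrow>\<^sub>0 nat) \<Rightarrow>\<^sub>0 rat) \<Rightarrow> ('n list \<times> ('n \<Rightarrow>\<^sub>0 nat) \<Rightarrow>\<^sub>0 rat)" where
  "tensor_diff q = pm_extend (\<lambda>(w, m). tensor (Poly_Mapping.single w 1) (c_diff q (Poly_Mapping.single m 1)))"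

lemma pm_linear_tensor_diff: "pm_linear (tensor_diff q)"
  unfolding tensor_diff_def by (rule linear_pm_extend)

lemma tensor_diff_tensor: "tensor_diff q (tensor a h) = tensor a (c_diff q h)"
  by (rule pm_linear_tensor_eqI[OF pm_linear_tensor_diff])
    (simp_all add: pm_linear_tensor_left pm_linear_comp[OF pm_linear_tensor_right pm_linear_c_diff(1)]
      tensor_diff_def)

text \<open>Taking a row acts on the left factor only and so commutes with operators on the right
  factor. This tests harmonicity row by row.\<close>

lemma tensor_row_tensor_diff: "tensor_row w (tensor_diff q t) = c_diff q (tensor_row w t)"
proof (rule pm_linear_eqI[of "\<lambda>t. tensor_row w (tensor_diff q t)"])
  fix x :: "'a list \<times> ('a \<Rightarrow>\<^sub>0 nat)"
  obtain w' m where x: "Poly_Mapping.single x 1 =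
      (tensor (Poly_Mapping.single w' 1) (Poly_Mapping.single m 1) :: _ \<Rightarrow>\<^sub>0 rat)"
    by (cases x) simp
  show "tensor_row w (tensor_diff q (Poly_Mapping.single x 1)) =
      c_diff q (tensor_row w (Poly_Mapping.single x 1))"
    unfolding x tensor_diff_tensor tensor_row_tensor
    by (simp only: pm_linear_pscale[OF pm_linear_c_diff(1)])
qed (rule pm_linear_comp[OF pm_linear_tensor_row pm_linear_tensor_diff]
    pm_linear_comp[OF pm_linear_c_diff(1) pm_linear_tensor_row])+

lemma tensor_diff_in:
  assumes "t \<in> tensor_space V UNIV"
  shows "tensor_diff q t \<in> tensor_space V UNIV"
proof (rule pm_linear_image_in_span[OF pm_linear_tensor_diff _ subspace_tensor_space
      assms[unfolded tensor_space_def]])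
  fix x :: "'a list \<times> ('a \<Rightarrow>\<^sub>0 nat) \<Rightarrow>\<^sub>0 rat"
  assume "x \<in> {tensor a h |a h. a \<in> V \<and> h \<in> UNIV}"
  then obtain a h where x: "x = tensor a h" "a \<in> V" by blast
  show "tensor_diff q x \<in> tensor_space V UNIV"
    unfolding x(1) tensor_diff_tensor by (rule tensor_in_tensor_space[OF x(2) UNIV_I])
qed

lemma nc_diff_tensor_mult:
  assumes "t \<in> tensor_space env_derived UNIV"
  shows "nc_diff p (tensor_mult t) = tensor_mult (tensor_diff (abel p) t)"
proof -
  have "nc_diff p (tensor_mult t) - tensor_mult (tensor_diff (abel p) t) \<in> {0}"
  proof (rule pm_linear_image_in_span[OF _ _ pm.subspace_single_0 assms[unfolded tensor_space_def]])
    show "pm_linear (\<lambda>t. nc_diff p (tensor_mult t) - tensor_mult (tensor_diff (abel p) t))"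
      by (rule pm_linear_diff_fun[OF pm_linear_comp[OF pm_linear_nc_diff(1) pm_linear_tensor_mult]
            pm_linear_comp[OF pm_linear_tensor_mult pm_linear_tensor_diff]])
  qed (auto simp: tensor_mult_tensor tensor_diff_tensor nc_diff_env_derived_symz)
  then show ?thesis by simp
qed

section \<open>Injectivity on tensors with left factor in \<A>'\<close>

lemma foldr_partial_deriv_single:
  "\<exists>c. foldr partial_deriv v (Poly_Mapping.single m 1) = Poly_Mapping.single (m - content v) c \<and>
    (c \<noteq> 0 \<longleftrightarrow> (\<forall>j. count_list v j \<le> Poly_Mapping.lookup m j))"
proof (induction v)
  case (Cons i v)
  then obtain c where c: "foldr partial_deriv v (Poly_Mapping.single m 1) = Poly_Mapping.single (m - content v) c"
    "c \<noteq> 0 \<longleftrightarrow> (\<forall>j. count_list v j \<le> Poly_Mapping.lookup m j)" by blast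
  have "foldr partial_deriv (i # v) (Poly_Mapping.single m 1) =
      Poly_Mapping.single (m - content (i # v)) (c * of_nat (Poly_Mapping.lookup m i - count_list v i))"
    by (simp add: c(1) partial_deriv_single lookup_minus diff_diff_add add.commute)
  moreover have "c * of_nat (Poly_Mapping.lookup m i - count_list v i) \<noteq> 0 \<longleftrightarrow>
      (\<forall>j. count_list (i # v) j \<le> Poly_Mapping.lookup m j)"
  proof -
    have "(\<forall>j. count_list (i # v) j \<le> Poly_Mapping.lookup m j) \<longleftrightarrow>
        (\<forall>j. count_list v j \<le> Poly_Mapping.lookup m j) \<and> count_list v i < Poly_Mapping.lookup m i"
      (is "?L \<longleftrightarrow> ?R")
    proof
      assume L: ?L
      have "count_list v j \<le> Poly_Mapping.lookup m j" for j
        using spec[OF L, of j] by (simp split: if_splits)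
      then show ?R using spec[OF L, of i] by simp
    qed simp
    then show ?thesis using c(2) by (simp only: mult_eq_0_iff of_nat_eq_0_iff diff_is_0_eq) auto
  qed
  ultimately show ?case by blast
qed auto

lemma symz_const: "symz (Poly_Mapping.single 0 c) = Poly_Mapping.single [] c"
proof -
  have "{w :: 'a list. content w = 0} = {[]}"
    using length_content[of _ 0] by auto
  then show ?thesis
    by (simp add: symz_def words_sum_def num_words_def)
qed

text \<open>A top-degree derivative isolates a single column, because it kills every other monomial.\<close>

lemma tensor_mult_eq_0_imp:
  assumes t: "t \<in> tensor_space env_derived UNIV" and 0: "tensor_mult t = 0"
  shows "t = 0"
proof (rule ccontr)
  let ?deg = "\<lambda>m :: 'a \<Rightarrow>\<^sub>0 nat. \<Sum>i\<in>UNIV. Poly_Mapping.lookup m i"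
  assume "t \<noteq> 0"
  define M where "M = snd ` Poly_Mapping.keys t"
  have M: "finite M" "M \<noteq> {}" using \<open>t \<noteq> 0\<close> by (auto simp: M_def)
  then have "Max (?deg ` M) \<in> ?deg ` M" by (intro Max_in) auto
  then obtain m0 where m0: "m0 \<in> M" "\<And>m. m \<in> M \<Longrightarrow> ?deg m \<le> ?deg m0"
    using M by (metis (no_types, lifting) Max_ge finite_imageI image_iff)
  obtain v where v: "content v = m0" using ex_content by blast
  obtain c where c: "foldr partial_deriv v (Poly_Mapping.single m0 1) = Poly_Mapping.single 0 c" "c \<noteq> 0"
    using foldr_partial_deriv_single[of v m0] v by auto
  have other: "foldr partial_deriv v (Poly_Mapping.single m 1) = 0" if "m \<in> M" "m \<noteq> m0" for m
  proof -
    have "\<not> (\<forall>j. count_list v j \<le> Poly_Mapping.lookup m j)"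
    proof
      \<comment> \<open>As \<open>m0\<close> has maximal degree, a monomial of \<open>M\<close> that
        dominates it has the same degree and therefore equals it.\<close>
      assume le: "\<forall>j. count_list v j \<le> Poly_Mapping.lookup m j"
      have "?deg m0 = (\<Sum>j\<in>UNIV. count_list v j)" using v by auto
      then have "(\<Sum>j\<in>UNIV. count_list v j) = ?deg m"
        using m0(2)[OF that(1)] sum_mono[of UNIV "count_list v" "Poly_Mapping.lookup m"] le by simp
      then have "count_list v j = Poly_Mapping.lookup m j" for j
        using sum_mono_inv[of "count_list v" UNIV "Poly_Mapping.lookup m" j] le by simp
      then have "m = m0" using v by (intro poly_mapping_eqI) auto
      with that show False by simp
    qed
    then show ?thesis using foldr_partial_deriv_single[of v m] by auto
  qed
  have col: "tensor_col m t \<in> env_derived" for m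
    by (rule tensor_col_in[OF subspace_env_derived t])
  have lin: "pm_linear (foldr hausdorff_deriv v)"
    by (rule pm_linear_foldr[OF pm_linear_hausdorff_deriv])
  have "0 = foldr hausdorff_deriv v (tensor_mult t)"
    using 0 by (simp add: pm_linear_0[OF lin])
  also have "\<dots> = foldr hausdorff_deriv v (tensor_mult
      (\<Sum>m\<in>M. tensor (tensor_col m t) (Poly_Mapping.single m 1)))"
    using sum_tensor_col[of M t] M by (simp add: M_def)
  also have "\<dots> = (\<Sum>m\<in>M. tensor_col m t * symz (foldr partial_deriv v (Poly_Mapping.single m 1)))"
    by (simp only: pm_linear_sum[OF pm_linear_tensor_mult] pm_linear_sum[OF lin] tensor_mult_tensor
        foldr_hausdorff_deriv_env_derived[OF col] foldr_hausdorff_deriv_symz)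
  also have "\<dots> = (\<Sum>m\<in>M. if m = m0 then pscale c (tensor_col m0 t) else 0)"
    by (rule sum.cong) (auto simp: other c symz_const pm_linear_0[OF pm_linear_symz])
  also have "\<dots> = pscale c (tensor_col m0 t)" using M m0 by simp
  finally have "tensor_col m0 t = 0" using c(2) by simp
  moreover obtain w where "(w, m0) \<in> Poly_Mapping.keys t" using m0(1) by (auto simp: M_def)
  ultimately show False
    by (metis in_keys_iff lookup_tensor_col lookup_zero)
qed

section \<open>Surjectivity: rearranging words modulo shorter ones\<close>

definition reduced_span :: "nat \<Rightarrow> 'n ncpoly set" where
  "reduced_span d = pm.span {a * Poly_Mapping.single u 1 |a u. a \<in> env_derived \<and> length u + 2 \<le> d}"

lemma subspace_reduced_span: "pm.subspace (reduced_span d)"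
  by (simp add: reduced_span_def)

lemma in_reduced_span:
  "a \<in> env_derived \<Longrightarrow> length u + 2 \<le> d \<Longrightarrow> a * Poly_Mapping.single u 1 \<in> reduced_span d"
  unfolding reduced_span_def by (rule pm.span_base) auto

text \<open>Write \<open>x_i a u\<close> as \<open>[x_i, a] u + a x_i u\<close>: the bracket stays
  in \<A>', and the word grows by at most one letter.\<close>

lemma var_times_reduced_span:
  assumes "p \<in> reduced_span d"
  shows "Poly_Mapping.single [i] 1 * p \<in> reduced_span (Suc d)"
proof (rule pm_linear_image_in_span[OF pm_linear_times_right _ subspace_reduced_span
      assms[unfolded reduced_span_def]])
  fix x :: "'a ncpoly"
  assume "x \<in> {a * Poly_Mapping.single u 1 |a u. a \<in> env_derived \<and> length u + 2 \<le> d}"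
  then obtain a u where x: "x = a * Poly_Mapping.single u 1" "a \<in> env_derived" "length u + 2 \<le> d"
    by auto
  have "Poly_Mapping.single [i] 1 * x = lie_bracket (nc_var i) a * Poly_Mapping.single u 1 +
      a * (Poly_Mapping.single [i] 1 * Poly_Mapping.single u 1)"
    unfolding x lie_bracket_def nc_var_def by (simp only: algebra_simps)
  also have "\<dots> \<in> reduced_span (Suc d)"
    using x(3) by (auto intro!: pm.subspace_add[OF subspace_reduced_span] in_reduced_span
        lie_bracket_var_env_derived x(2))
  finally show "Poly_Mapping.single [i] 1 * x \<in> reduced_span (Suc d)" .
qed

text \<open>Move \<open>i\<close> to the front of \<open>u\<close> by induction, then past
  \<open>j\<close>. The swap costs \<open>[x_j, x_i]\<close> times \<open>u @ v\<close>, a word two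
  letters shorter, which is the origin of the bound in \<open>reduced_span\<close>.\<close>

lemma move_to_front_reduced_span:
  "Poly_Mapping.single (u @ i # v) 1 - Poly_Mapping.single (i # u @ v) 1
    \<in> reduced_span (Suc (length u + length v))"
proof (induction u)
  case Nil
  then show ?case by (simp add: pm.subspace_0[OF subspace_reduced_span])
next
  case (Cons j u)
  have "Poly_Mapping.single ((j # u) @ i # v) 1 - Poly_Mapping.single (i # (j # u) @ v) 1 =
      Poly_Mapping.single [j] 1 * (Poly_Mapping.single (u @ i # v) 1 - Poly_Mapping.single (i # u @ v) 1) +
      lie_bracket (nc_var j) (nc_var i) * Poly_Mapping.single (u @ v) (1 :: rat)"
    by (simp add: lie_bracket_def nc_var_def right_diff_distrib left_diff_distrib)
  also have "\<dots> \<in> reduced_span (Suc (length (j # u) + length v))"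
    using var_times_reduced_span[OF Cons, of j]
      subsetD[OF derived_subset_env_derived lie_bracket_in_derived[OF nc_var_in_free_lie nc_var_in_free_lie], of j i]
    by (intro pm.subspace_add[OF subspace_reduced_span] in_reduced_span) simp_all
  finally show ?case .
qed

text \<open>Bring the first letter of \<open>w\<close> to the front of \<open>w'\<close> and compare
  the remaining words by induction.\<close>

lemma content_eq_reduced_span:
  "content w = content w' \<Longrightarrow>
    Poly_Mapping.single w 1 - Poly_Mapping.single w' 1 \<in> reduced_span (length (w :: 'n::finite list))"
proof (induction w arbitrary: w')
  case Nil
  then have "w' = []" using length_content[of "[]" 0] length_content[of w' 0] by simp
  then show ?case by (simp add: pm.subspace_0[OF subspace_reduced_span])
next
  case (Cons i w)
  have "count_list w' i = count_list (i # w) i" using Cons.prems by (metis lookup_content)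
  then have "i \<in> set w'" by (metis count_notin count_list.simps(2) add_is_0 zero_neq_one)
  then obtain u v where w': "w' = u @ i # v" by (meson split_list)
  have c: "content w = content (u @ v)"
  proof -
    have "Poly_Mapping.single i 1 + content w = Poly_Mapping.single i 1 + content (u @ v)"
      using Cons.prems unfolding w' content_simps by (simp add: ac_simps)
    then show ?thesis by simp
  qed
  then have len: "length w = length u + length v"
    using length_content[OF c] length_content[of "u @ v"] by simp
  have "Poly_Mapping.single (i # w) 1 - Poly_Mapping.single w' 1 =
      Poly_Mapping.single [i] 1 * (Poly_Mapping.single w 1 - Poly_Mapping.single (u @ v) 1) -
      (Poly_Mapping.single (u @ i # v) 1 - Poly_Mapping.single (i # u @ v) (1 :: rat))"
    by (simp add: w' right_diff_distrib)
  also have "\<dots> \<in> reduced_span (length (i # w))"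
    using var_times_reduced_span[OF Cons.IH[OF c], of i] move_to_front_reduced_span[of u i v]
    by (intro pm.subspace_diff[OF subspace_reduced_span, of "Poly_Mapping.single [i] 1 * _"])
      (simp_all add: len)
  finally show ?case .
qed

text \<open>By induction on its length every word is reached: it differs from the symmetrised
  monomial of its content by \<A>'-multiples of shorter words.\<close>

lemma range_tensor_mult: "tensor_mult ` tensor_space env_derived UNIV = (UNIV :: 'n::finite ncpoly set)"
proof -
  let ?T = "tensor_mult ` tensor_space env_derived UNIV :: 'n ncpoly set"
  interpret tm: Vector_Spaces.linear pscale pscale "tensor_mult :: _ \<Rightarrow> 'n ncpoly"
    by (rule pm_linear_tensor_mult)
  have sub: "pm.subspace ?T"
    by (rule tm.subspace_image[OF subspace_tensor_space])
  have gen: "a * symz h \<in> ?T" if "a \<in> env_derived" for a h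
    using tensor_in_tensor_space[OF that UNIV_I, of h] by (metis image_eqI tensor_mult_tensor)
  \<comment> \<open>The image is a left module over \<A>', since \<A>' is closed under
    products.\<close>
  have left: "a * p \<in> ?T" if a: "a \<in> env_derived" and p: "p \<in> ?T" for a p
  proof -
    have "p \<in> pm.span (tensor_mult ` {tensor a h |a h. a \<in> env_derived \<and> h \<in> UNIV})"
      using p unfolding tensor_space_def tm.span_image .
    then show ?thesis
    proof (rule pm_linear_image_in_span[OF pm_linear_times_right[of a] _ sub, rotated])
      fix x :: "'n ncpoly" assume "x \<in> tensor_mult ` {tensor b h |b h. b \<in> env_derived \<and> h \<in> UNIV}"
      then obtain b h where x: "x = tensor_mult (tensor b h)" "b \<in> env_derived"
        by blast
      have "a * x = (a * b) * symz h"
        unfolding x(1) tensor_mult_tensor by (simp only: mult.assoc)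
      then show "a * x \<in> ?T"
        using gen[OF times_in_env_derived[OF a x(2)], of h] by (simp only:)
    qed
  qed
  have word: "Poly_Mapping.single w 1 \<in> ?T" for w
  proof (induction "length w" arbitrary: w rule: less_induct)
    case less
    have red: "reduced_span (length w) \<subseteq> ?T"
      unfolding reduced_span_def using less by (intro pm.span_minimal[OF _ sub]) (auto intro!: left)
    let ?m = "content w"
    \<comment> \<open>The word \<open>w\<close> is the average of all words \<open>w'\<close> of its
      content plus the average of the differences \<open>w - w'\<close>.\<close>
    have "symz (Poly_Mapping.single ?m 1) + pscale (1 / of_nat (num_words ?m))
        (\<Sum>w' | content w' = ?m. Poly_Mapping.single w 1 - Poly_Mapping.single w' 1) =
        Poly_Mapping.single w 1"
      using num_words_pos[of ?m]
      by (simp only: symz_single words_sum_def sum_subtractf sum_const_pscale num_words_def[symmetric]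
          pm.scale_right_diff_distrib) simp
    moreover have "symz (Poly_Mapping.single ?m 1) + pscale (1 / of_nat (num_words ?m))
        (\<Sum>w' | content w' = ?m. Poly_Mapping.single w 1 - Poly_Mapping.single w' 1) \<in> ?T"
    proof (intro pm.subspace_add[OF sub] pm.subspace_scale[OF sub] pm.subspace_sum[OF sub])
      show "symz (Poly_Mapping.single ?m 1) \<in> ?T"
        using gen[OF one_in_env_derived, of "Poly_Mapping.single ?m 1"] by simp
      fix w' assume "w' \<in> {w'. content w' = ?m}"
      then have "?m = content w'" by simp
      from subsetD[OF red content_eq_reduced_span[OF this]]
      show "Poly_Mapping.single w 1 - Poly_Mapping.single w' 1 \<in> ?T" .
    qed
    ultimately show ?case by (simp only:)
  qed
  have "p \<in> ?T" for p
    by (subst pm_expand) (intro pm.subspace_sum[OF sub] pm.subspace_scale[OF sub] word)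
  then show ?thesis by blast
qed

text \<open>Through \<open>tensor_mult\<close> the operators \<open>p(\<partial>)\<close> act as
  \<open>1 \<otimes> q(\<partial>)\<close> with \<open>q = abel p\<close>. By injectivity the
  preimage of a harmonic element is killed as well, so its rows are harmonic while its columns lie
  in \<A>'.\<close>

lemma MHar_eq: "MHar = tensor_mult ` tensor_space env_derived (harmonic :: 'n::finite cpoly set)"
proof (intro equalityI subsetI)
  fix f :: "'n ncpoly" assume f: "f \<in> MHar"
  obtain t where t: "t \<in> tensor_space env_derived UNIV" "f = tensor_mult t"
    using range_tensor_mult by (metis UNIV_I imageE)
  have "c_diff q (tensor_row w t) = 0" if q: "q \<in> c_Sym_plus" for q w
  proof -
    \<comment> \<open>The lift \<open>symz q\<close> realises \<open>q\<close> because
      \<open>abel (symz q) = q\<close>.\<close>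
    have "nc_diff (symz q) f = 0" using f symz_c_Sym_plus[OF q] by (auto simp: MHar_def)
    then have "tensor_mult (tensor_diff q t) = 0" using t by (simp add: nc_diff_tensor_mult)
    then have "tensor_diff q t = 0" using tensor_mult_eq_0_imp tensor_diff_in t(1) by blast
    then show ?thesis
      using tensor_row_tensor_diff[of w q t] by (simp add: pm_linear_0[OF pm_linear_tensor_row])
  qed
  then have "tensor_row w t \<in> harmonic" for w by (simp add: harmonic_def)
  then have "t \<in> tensor_space env_derived harmonic"
    using tensor_col_in[OF subspace_env_derived t(1)]
    by (intro in_tensor_space_slices subspace_env_derived)
  with t show "f \<in> tensor_mult ` tensor_space env_derived harmonic" by blast
next
  fix f :: "'n ncpoly" assume "f \<in> tensor_mult ` tensor_space env_derived harmonic"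
  then obtain t where t: "t \<in> tensor_space env_derived harmonic" "f = tensor_mult t" by blast
  have "nc_diff p f = 0" if p: "p \<in> NCSym_plus" for p
  proof -
    have "nc_diff p (tensor_mult t) \<in> {0}"
      by (rule pm_linear_image_in_span[OF pm_linear_comp[OF pm_linear_nc_diff(1) pm_linear_tensor_mult]
            _ pm.subspace_single_0 t(1)[unfolded tensor_space_def]])
        (use abel_NCSym_plus[OF p] in \<open>auto simp: tensor_mult_tensor nc_diff_env_derived_symz
          harmonic_def pm_linear_0[OF pm_linear_symz]\<close>)
    then show ?thesis using t by simp
  qed
  then show "f \<in> MHar" by (simp add: MHar_def)
qed


section \<open>Equivariance\<close>

text \<open>Relabelling is an algebra endomorphism that permits any map on letters, so it respects
  whatever letters and brackets generate.\<close>

lemma free_lie_nc_perm: "a \<in> free_lie \<Longrightarrow> nc_perm \<sigma> a \<in> free_lie"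
proof -
  have "free_lie \<subseteq> {a. nc_perm \<sigma> a \<in> free_lie}"
    by (rule free_lie_minimal[OF pm_linear_subspace_vimage[OF pm_linear_nc_perm subspace_free_lie]])
      (use nc_var_in_free_lie lie_bracket_in_free_lie in
        \<open>auto simp: nc_var_def lie_bracket_def pm_linear_diff[OF pm_linear_nc_perm] nc_perm_times\<close>)
  then show "a \<in> free_lie \<Longrightarrow> nc_perm \<sigma> a \<in> free_lie" by blast
qed

lemma env_derived_nc_perm: "a \<in> env_derived \<Longrightarrow> nc_perm \<sigma> a \<in> env_derived"
proof -
  let ?A = "{a. nc_perm \<sigma> a \<in> env_derived}"
  have sub: "pm.subspace ?A"
    by (rule pm_linear_subspace_vimage[OF pm_linear_nc_perm subspace_env_derived])
  have "derived_free_lie \<subseteq> ?A"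
    unfolding derived_free_lie_def
  proof (rule pm.span_minimal[OF subsetI sub])
    fix x :: "'a ncpoly" assume "x \<in> {lie_bracket a b |a b. a \<in> free_lie \<and> b \<in> free_lie}"
    then obtain a b where x: "x = lie_bracket a b" "a \<in> free_lie" "b \<in> free_lie" by auto
    have "nc_perm \<sigma> x = lie_bracket (nc_perm \<sigma> a) (nc_perm \<sigma> b)"
      by (simp add: x(1) lie_bracket_def pm_linear_diff[OF pm_linear_nc_perm] nc_perm_times)
    then show "x \<in> ?A"
      using subsetD[OF derived_subset_env_derived lie_bracket_in_derived[OF free_lie_nc_perm free_lie_nc_perm]] x
      by auto
  qed
  moreover have "nc_perm \<sigma> 1 = 1" by (simp add: one_ncpoly)
  ultimately have "env_derived \<subseteq> ?A"
    by (intro env_derived_minimal[OF sub]) (auto simp: nc_perm_times one_in_env_derived times_in_env_derived)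
  then show "a \<in> env_derived \<Longrightarrow> nc_perm \<sigma> a \<in> env_derived" by blast
qed

section \<open>Invariance of the noncommutative and commutative harmonics\<close>

lemma nc_perm_hausdorff_deriv:
  assumes "bij \<sigma>"
  shows "nc_perm \<sigma> (hausdorff_deriv i f) = hausdorff_deriv (\<sigma> i) (nc_perm \<sigma> f)"
proof (rule pm_linear_eqI[of "\<lambda>f. nc_perm \<sigma> (hausdorff_deriv i f)"])
  fix w
  \<comment> \<open>Injectivity of \<open>\<sigma>\<close> prevents other letters from being
    relabelled to \<open>\<sigma> i\<close>.\<close>
  have "{k. k < length w \<and> w ! k = i} = {k. k < length (map \<sigma> w) \<and> map \<sigma> w ! k = \<sigma> i}"
    using bij_is_inj[OF assms] by (auto simp: inj_eq)
  then show "nc_perm \<sigma> (hausdorff_deriv i (Poly_Mapping.single w 1)) =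
      hausdorff_deriv (\<sigma> i) (nc_perm \<sigma> (Poly_Mapping.single w 1))"
    by (simp only: nc_perm_single hausdorff_deriv_single pm_linear_sum[OF pm_linear_nc_perm]
        map_append take_map drop_map)
qed (rule pm_linear_comp[OF pm_linear_nc_perm pm_linear_hausdorff_deriv]
    pm_linear_comp[OF pm_linear_hausdorff_deriv pm_linear_nc_perm])+

lemma nc_perm_nc_diff:
  assumes "bij \<sigma>"
  shows "nc_perm \<sigma> (nc_diff p f) = nc_diff (nc_perm \<sigma> p) (nc_perm \<sigma> f)"
proof (rule pm_linear_eqI[of "\<lambda>p. nc_perm \<sigma> (nc_diff p f)"])
  fix w
  have "nc_perm \<sigma> (foldr hausdorff_deriv w f) = foldr hausdorff_deriv (map \<sigma> w) (nc_perm \<sigma> f)"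
    by (induction w) (simp_all add: nc_perm_hausdorff_deriv[OF assms])
  then show "nc_perm \<sigma> (nc_diff (Poly_Mapping.single w 1) f) =
      nc_diff (nc_perm \<sigma> (Poly_Mapping.single w 1)) (nc_perm \<sigma> f)"
    by (simp add: nc_diff_def)
qed (rule pm_linear_comp[OF pm_linear_nc_perm pm_linear_nc_diff(2)]
    pm_linear_comp[OF pm_linear_nc_diff(2) pm_linear_nc_perm])+

text \<open>Conjugation by \<open>\<sigma>\<close> turns \<open>p(\<partial>)\<close> into the
  operator of the permuted polynomial, which is \<open>p\<close> again when \<open>p\<close> is
  symmetric.\<close>

lemma MHar_nc_perm:
  assumes "bij \<sigma>" "f \<in> MHar"
  shows "nc_perm \<sigma> f \<in> MHar"
proof -
  have "nc_diff p (nc_perm \<sigma> f) = 0" if p: "p \<in> NCSym_plus" for p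
  proof -
    have "nc_perm \<sigma> p = p" using p assms(1) by (simp add: NCSym_plus_def NCSym_def)
    then have "nc_diff p (nc_perm \<sigma> f) = nc_perm \<sigma> (nc_diff p f)"
      by (simp add: nc_perm_nc_diff[OF assms(1)])
    also have "\<dots> = 0"
      using assms(2) p by (simp add: MHar_def pm_linear_0[OF pm_linear_nc_perm])
    finally show ?thesis .
  qed
  then show ?thesis by (simp add: MHar_def)
qed

text \<open>The case \<open>a = 1\<close> of the action on products, combined with the injectivity
  of \<open>symz\<close>. It transfers invariance from \<open>MHar\<close> to
  \<open>harmonic\<close>.\<close>

lemma symz_in_MHar_iff: "symz h \<in> MHar \<longleftrightarrow> h \<in> harmonic"
proof -
  have eq: "nc_diff p (symz h) = symz (c_diff (abel p) h)" for p
    using nc_diff_env_derived_symz[OF one_in_env_derived, of p h] by simp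
  have "c_diff q h = 0" if "symz h \<in> MHar" "q \<in> c_Sym_plus" for q
  proof -
    have "symz (c_diff q h) = 0"
      using that symz_c_Sym_plus[OF that(2)] eq[of "symz q"] by (simp add: MHar_def)
    then show ?thesis by (metis abel_symz pm_linear_0[OF pm_linear_abel])
  qed
  moreover have "nc_diff p (symz h) = 0" if "h \<in> harmonic" "p \<in> NCSym_plus" for p
    using that abel_NCSym_plus[OF that(2)] by (simp add: eq harmonic_def pm_linear_0[OF pm_linear_symz])
  ultimately show ?thesis by (auto simp: MHar_def harmonic_def)
qed

lemma harmonic_c_perm: "bij \<sigma> \<Longrightarrow> h \<in> harmonic \<Longrightarrow> c_perm \<sigma> h \<in> harmonic"
  by (simp add: symz_in_MHar_iff[symmetric] nc_perm_symz[symmetric] MHar_nc_perm)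

section \<open>Group action laws and the module structures\<close>

lemma nc_perm_id: "nc_perm id f = f"
  and nc_perm_comp: "nc_perm (\<sigma> \<circ> \<tau>) f = nc_perm \<sigma> (nc_perm \<tau> f)"
  by (rule pm_linear_eqI[of "nc_perm _"];
      simp add: comp_def pm_linear_nc_perm pm_linear_id pm_linear_comp[OF pm_linear_nc_perm pm_linear_nc_perm])+

text \<open>Every polynomial is an abelianisation, so the laws descend from words, where they are
  laws of \<open>map\<close>.\<close>

lemma c_perm_id: "c_perm id h = h"
  and c_perm_comp: "c_perm (\<sigma> \<circ> \<tau>) h = c_perm \<sigma> (c_perm \<tau> h)"
  using abel_nc_perm[of id "symz h"] abel_nc_perm[of "\<sigma> \<circ> \<tau>" "symz h"]
  by (simp_all add: nc_perm_id nc_perm_comp abel_nc_perm)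

lemma pm_linear_eqI_tensor:
  assumes "pm_linear f" "pm_linear g" "\<And>a h. f (tensor a h) = g (tensor a h)"
  shows "f t = g t"
proof (rule pm_linear_eqI[OF assms(1,2)])
  fix x :: "'a \<times> 'b"
  show "f (Poly_Mapping.single x 1) = g (Poly_Mapping.single x 1)"
    using assms(3)[of "Poly_Mapping.single (fst x) 1" "Poly_Mapping.single (snd x) 1"] by simp
qed

lemma diag_perm_id: "diag_perm id t = t"
  by (rule pm_linear_eqI_tensor[OF pm_linear_diag_perm pm_linear_id])
    (simp add: diag_perm_tensor nc_perm_id c_perm_id)

lemma diag_perm_comp: "diag_perm (\<sigma> \<circ> \<tau>) t = diag_perm \<sigma> (diag_perm \<tau> t)"
  by (rule pm_linear_eqI_tensor[OF pm_linear_diag_perm pm_linear_comp[OF pm_linear_diag_perm pm_linear_diag_perm]])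
    (simp add: diag_perm_tensor nc_perm_comp c_perm_comp)

lemma tensor_mult_diag_perm:
  "bij \<sigma> \<Longrightarrow> tensor_mult (diag_perm \<sigma> t) = nc_perm \<sigma> (tensor_mult t)"
  by (rule pm_linear_eqI_tensor[OF pm_linear_comp[OF pm_linear_tensor_mult pm_linear_diag_perm]
        pm_linear_comp[OF pm_linear_nc_perm pm_linear_tensor_mult]])
    (simp add: diag_perm_tensor tensor_mult_tensor nc_perm_times nc_perm_symz)

lemma diag_perm_tensor_space:
  assumes "bij \<sigma>" "t \<in> tensor_space env_derived harmonic"
  shows "diag_perm \<sigma> t \<in> tensor_space env_derived harmonic"
  by (rule pm_linear_image_in_span[OF pm_linear_diag_perm _ subspace_tensor_space
        assms(2)[unfolded tensor_space_def]])
    (auto simp: diag_perm_tensor intro!: tensor_in_tensor_space env_derived_nc_perm harmonic_c_perm assms(1))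

lemma Sn_module_MHar: "Sn_module nc_perm (MHar :: 'n::finite ncpoly set)"
proof -
  have "pm.subspace (MHar :: 'n ncpoly set)"
    by (auto simp: pm.subspace_def MHar_def pm_linear_0[OF pm_linear_nc_diff(1)]
        pm_linear_add[OF pm_linear_nc_diff(1)] pm_linear_pscale[OF pm_linear_nc_diff(1)])
  then show ?thesis
    by (simp add: Sn_module_def MHar_nc_perm pm_linear_add[OF pm_linear_nc_perm]
        pm_linear_pscale[OF pm_linear_nc_perm] nc_perm_id nc_perm_comp)
qed

lemma Sn_module_tensor_space:
  "Sn_module diag_perm (tensor_space env_derived (harmonic :: 'n::finite cpoly set))"
  by (simp add: Sn_module_def subspace_tensor_space diag_perm_tensor_space
      pm_linear_add[OF pm_linear_diag_perm] pm_linear_pscale[OF pm_linear_diag_perm]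
      diag_perm_id diag_perm_comp)

theorem theorem3p1:
  shows "Sn_isomorphic nc_perm (MHar :: 'n::finite ncpoly set)
           diag_perm (tensor_space (env_derived :: 'n ncpoly set) (harmonic :: 'n cpoly set))"
proof -
  let ?W = "tensor_space (env_derived :: 'n ncpoly set) (harmonic :: 'n cpoly set)"
  \<comment> \<open>\<open>Sn_isomorphic\<close> asks for a map out of \<open>MHar\<close>, while
    the explicit formula \<open>tensor_mult\<close> runs the other way.\<close>
  define \<phi> where "\<phi> = inv_into ?W tensor_mult"
  have sub: "pm.subspace ?W" by (rule subspace_tensor_space)
  have W: "?W \<subseteq> tensor_space env_derived UNIV"
    unfolding tensor_space_def by (intro pm.span_mono) auto
  have inj: "inj_on tensor_mult ?W"
  proof (rule inj_onI)
    fix s t :: "'n list \<times> ('n \<Rightarrow>\<^sub>0 nat) \<Rightarrow>\<^sub>0 rat"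
    assume st: "s \<in> ?W" "t \<in> ?W" "tensor_mult s = tensor_mult t"
    have "s - t = 0"
    proof (rule tensor_mult_eq_0_imp)
      show "s - t \<in> tensor_space env_derived UNIV"
        by (rule subsetD[OF W pm.subspace_diff[OF sub st(1,2)]])
      show "tensor_mult (s - t) = 0"
        unfolding pm_linear_diff[OF pm_linear_tensor_mult] st(3) by (rule diff_self)
    qed
    then show "s = t" by simp
  qed
  have \<phi>: "\<phi> (tensor_mult t) = t" if "t \<in> ?W" for t
    unfolding \<phi>_def by (rule inv_into_f_f[OF inj that])
  have "bij_betw \<phi> MHar ?W"
    unfolding \<phi>_def MHar_eq by (intro bij_betw_inv_into inj_on_imp_bij_betw inj)
  \<comment> \<open>Elements of \<open>MHar\<close> are written as \<open>tensor_mult t\<close>,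
    which turns each law for \<open>\<phi>\<close> into the corresponding law for
    \<open>tensor_mult\<close>.\<close>
  moreover have "\<phi> (u + v) = \<phi> u + \<phi> v" if "u \<in> MHar" "v \<in> MHar" for u v
    using that pm.subspace_add[OF sub]
    by (auto simp: MHar_eq \<phi> pm_linear_add[OF pm_linear_tensor_mult, symmetric])
  moreover have "\<phi> (pscale c v) = pscale c (\<phi> v)" if "v \<in> MHar" for c v
    using that pm.subspace_scale[OF sub]
    by (auto simp: MHar_eq \<phi> pm_linear_pscale[OF pm_linear_tensor_mult, symmetric])
  moreover have "\<phi> (nc_perm \<sigma> v) = diag_perm \<sigma> (\<phi> v)" if "bij \<sigma>" "v \<in> MHar" for \<sigma> v
    using that
    by (auto simp: MHar_eq \<phi> tensor_mult_diag_perm[symmetric] diag_perm_tensor_space)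
  ultimately show ?thesis
    unfolding Sn_isomorphic_def using Sn_module_MHar Sn_module_tensor_space by blast
qed

end
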